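(* For every positive integer $n$, every $n$-vertex $\{K_4^{3-}, F_5\}$-free $3$-graph $\mathcal{H}$ with $\delta(\mathcal{H}) > \frac{4n^2}{45}$ is $3$-partite.
   Context: A $3$-graph is a collection $\mathcal{H}$ of $3$-element subsets (edges) of a finite vertex set $V(\mathcal{H})$. The degree of a vertex $v$ is the number of edges containing $v$, and $\delta(\mathcal{H})$ is the minimum degree. $K_4^{3-}$ is the $3$-graph on $\{a,b,c,d\}$ with edge set $\{abc, abd, acd\}$, and $F_5$ is the $3$-graph on $\{a,b,c,d,e\}$ with edge set $\{abc, abd, cde\}$; $\mathcal{H}$ is $\{K_4^{3-},F_5\}$-free if it contains no subgraph isomorphic to $K_4^{3-}$ or to $F_5$. $\mathcal{H}$ is $3$-partite if $V(\mathcal{H})$ can be partitioned into three sets such that every edge of $\mathcal{H}$ contains exactly one vertex from each set. *)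

theory Defs
  imports Complex_Main
begin

text \<open>A 3-graph is given by its vertex set \<open>V\<close> and its edge set \<open>E\<close>, so that isolated
  vertices are allowed.\<close>

definition three_graph :: "'a set \<Rightarrow> 'a set set \<Rightarrow> bool" where
  "three_graph V E \<longleftrightarrow> finite V \<and> (\<forall>e\<in>E. e \<subseteq> V \<and> card e = 3)"

definition degree :: "'a set set \<Rightarrow> 'a \<Rightarrow> nat" where
  "degree E v = card {e \<in> E. v \<in> e}"

text \<open>Only meaningful for finite nonempty \<open>V\<close>.\<close>

definition min_degree :: "'a set \<Rightarrow> 'a set set \<Rightarrow> nat" where
  "min_degree V E = Min (degree E ` V)"

definition subgraph :: "'a set \<Rightarrow> 'a set set \<Rightarrow> 'a set \<Rightarrow> 'a set set \<Rightarrow> bool" where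
  "subgraph V' E' V E \<longleftrightarrow> three_graph V' E' \<and> V' \<subseteq> V \<and> E' \<subseteq> E"

definition isomorphic :: "'a set \<Rightarrow> 'a set set \<Rightarrow> 'b set \<Rightarrow> 'b set set \<Rightarrow> bool" where
  "isomorphic V E W F \<longleftrightarrow> (\<exists>f. bij_betw f V W \<and> (\<lambda>e. f ` e) ` E = F)"

text \<open>Subgraphs need not be induced.\<close>

definition contains_copy :: "'a set \<Rightarrow> 'a set set \<Rightarrow> 'b set \<Rightarrow> 'b set set \<Rightarrow> bool" where
  "contains_copy V E W F \<longleftrightarrow> (\<exists>V' E'. subgraph V' E' V E \<and> isomorphic W F V' E')"

text \<open>Vertices \<open>a, b, c, d, e\<close> are encoded as \<open>0, 1, 2, 3, 4\<close>.\<close>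

definition K4m_verts :: "nat set" where
  "K4m_verts = {0, 1, 2, 3}"

definition K4m_edges :: "nat set set" where
  "K4m_edges = {{0, 1, 2}, {0, 1, 3}, {0, 2, 3}}"

definition F5_verts :: "nat set" where
  "F5_verts = {0, 1, 2, 3, 4}"

definition F5_edges :: "nat set set" where
  "F5_edges = {{0, 1, 2}, {0, 1, 3}, {2, 3, 4}}"

definition K4m_F5_free :: "'a set \<Rightarrow> 'a set set \<Rightarrow> bool" where
  "K4m_F5_free V E \<longleftrightarrow>
     \<not> contains_copy V E K4m_verts K4m_edges \<and> \<not> contains_copy V E F5_verts F5_edges"

definition three_partite :: "'a set \<Rightarrow> 'a set set \<Rightarrow> bool" where
  "three_partite V E \<longleftrightarrow>
     (\<exists>A B C. A \<union> B \<union> C = V \<and> A \<inter> B = {} \<and> A \<inter> C = {} \<and> B \<inter> C = {} \<and>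
        (\<forall>e\<in>E. card (e \<inter> A) = 1 \<and> card (e \<inter> B) = 1 \<and> card (e \<inter> C) = 1))"

end

theory Submission
  imports Defs
begin

text \<open>Join two vertices when some edge contains both. Freeness says that the vertices completing a
  fixed pair to an edge are pairwise non-adjacent in this shadow graph, so links of adjacent vertices are
  disjoint, and Turan's theorem applied to the union of the links over a clique shows that the shadow is
  \<open>K\<^sub>4\<close>-free. Every neighbourhood then spans a triangle-free graph with more than \<open>4n\<^sup>2/45\<close> edges, hence all
  degrees exceed \<open>149n/250\<close>. No neighbourhood contains a pentagon: summing, over a pentagon of large
  degree sum inside \<open>N(a)\<close>, the bounds on the sizes of the links of its vertices contradicts the
  hypothesis, the bounds being tight for a blow-up of the wheel with five spokes. Finally, without such
  wheels, the complement of a large maximal independent set is triangle-free, and even bipartite, because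
  a pentagon in it would have too small a degree sum.\<close>

section \<open>Edge bounds of Turan type\<close>

text \<open>The threshold belongs to a blow-up of the wheel: with weight 1/3 on the hub class and
  2/15 on each rim class, every link has exactly \<open>4/45 * n^2\<close> edges, and the shadow is
  not three-colourable. Excluding wheels therefore has no slack at relative hub degree 2/3. An
  arbitrary pentagon in \<open>N(a)\<close> shows merely that \<open>N(a)\<close> has relative size
  below 2/3. For a contradiction three of its vertices must have small degrees inside
  \<open>N(a)\<close>, which is arranged by letting the other two, \<open>x\<close> and
  \<open>y\<close>, be the ends of an edge of large degree sum, found by averaging. The obstacle is
  that a pentagon must pass through this edge: if none does, an explicit colouring by adjacency to
  \<open>x\<close> and closeness to \<open>y\<close> makes \<open>N(a)\<close> bipartite. The
  constants of the colouring argument come from the degree bound: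
  \<open>101/250 = 1 - 149/250\<close>, \<open>48/250 = 2 * 149/250 - 1\<close>,
  \<open>197/250 = 3 * 149/250 - 1\<close> and \<open>53/250 = 2 - 3 * 149/250\<close>. Adjacent
  pairs are counted as ordered pairs, so \<open>4/45\<close> appears as \<open>8/45\<close>.\<close>

definition arcs :: "('a \<Rightarrow> 'a \<Rightarrow> bool) \<Rightarrow> 'a set \<Rightarrow> ('a \<times> 'a) set" where
  "arcs R S = {(x, y). x \<in> S \<and> y \<in> S \<and> R x y}"

definition clique :: "('a \<Rightarrow> 'a \<Rightarrow> bool) \<Rightarrow> 'a set \<Rightarrow> bool" where
  "clique R K \<longleftrightarrow> (\<forall>x\<in>K. \<forall>y\<in>K. x \<noteq> y \<longrightarrow> R x y)"

definition indep :: "('a \<Rightarrow> 'a \<Rightarrow> bool) \<Rightarrow> 'a set \<Rightarrow> bool" where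
  "indep R S \<longleftrightarrow> (\<forall>x\<in>S. \<forall>y\<in>S. \<not> R x y)"

lemma indep_subset: "indep R S \<Longrightarrow> T \<subseteq> S \<Longrightarrow> indep R T"
  by (auto simp: indep_def)

lemma finite_arcs: "finite S \<Longrightarrow> finite (arcs R S)"
  by (rule finite_subset[of _ "S \<times> S"]) (auto simp: arcs_def)

lemma card_arcs: "finite S \<Longrightarrow> card (arcs R S) = (\<Sum>x\<in>S. card {y\<in>S. R x y})"
proof -
  assume "finite S"
  moreover have "arcs R S = (SIGMA x:S. {y\<in>S. R x y})"
    by (auto simp: arcs_def)
  ultimately show ?thesis
    by simp
qed

lemma ex_max_card:
  assumes "finite S" "P A0" "A0 \<subseteq> S"
  obtains A where "A \<subseteq> S" "P A" "\<forall>A'\<subseteq>S. P A' \<longrightarrow> card A' \<le> card A"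
proof -
  let ?F = "{A. A \<subseteq> S \<and> P A}"
  have "finite ?F" "?F \<noteq> {}"
    using assms by auto
  then have "Max (card ` ?F) \<in> card ` ?F" "\<And>A'. A' \<in> ?F \<Longrightarrow> card A' \<le> Max (card ` ?F)"
    by (auto intro!: Max_in)
  then show thesis
    using that by (smt (verit) imageE mem_Collect_eq)
qed

text \<open>The arcs split into those outside \<open>K\<close>, those inside \<open>K\<close>, and
  the crossing ones, which come in two directions; a vertex outside \<open>K\<close> misses at least
  one vertex of \<open>K\<close>.\<close>

lemma card_arcs_diff_clique:
  assumes "finite S" "K \<subseteq> S" "\<And>x y. R x y \<Longrightarrow> R y x" "\<And>x. \<not> R x x"
    and few: "\<And>x. x \<in> S - K \<Longrightarrow> card {y\<in>K. R x y} \<le> card K - 1"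
  shows "card (arcs R S) \<le> card (arcs R (S - K)) + card K * (card K - 1)
           + 2 * (card S - card K) * (card K - 1)"
proof -
  have fK: "finite K"
    using assms finite_subset by blast
  let ?X = "SIGMA x:(S - K). {y\<in>K. R x y}"
  let ?Y = "SIGMA x:K. {y\<in>K. R x y}"
  have "arcs R S \<subseteq> (arcs R (S - K) \<union> ?Y) \<union> (?X \<union> prod.swap ` ?X)"
    using assms(2,3) by (force simp: arcs_def image_iff)
  then have "card (arcs R S) \<le> card ((arcs R (S - K) \<union> ?Y) \<union> (?X \<union> prod.swap ` ?X))"
    using assms(1) fK by (intro card_mono) (auto simp: finite_arcs)
  also have "\<dots> \<le> (card (arcs R (S - K)) + card ?Y) + (card ?X + card (prod.swap ` ?X))"
    by (meson add_mono card_Un_le le_trans)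
  also have "card (prod.swap ` ?X) = card ?X"
    by (intro card_image) (auto simp: inj_on_def)
  also have "card ?X \<le> (card S - card K) * (card K - 1)"
  proof -
    have "card ?X = (\<Sum>x\<in>S - K. card {y\<in>K. R x y})"
      using assms(1) fK by simp
    also have "\<dots> \<le> (\<Sum>x\<in>S - K. card K - 1)"
      using few by (intro sum_mono)
    finally show ?thesis
      using assms(2) fK by (simp add: card_Diff_subset)
  qed
  also have "card ?Y \<le> card K * (card K - 1)"
  proof -
    have "card {y\<in>K. R x y} \<le> card K - 1" if "x \<in> K" for x
    proof -
      have "card {y\<in>K. R x y} \<le> card (K - {x})"
        using assms(4) fK by (intro card_mono) auto
      then show ?thesis
        using that fK by simp
    qed
    then have "(\<Sum>x\<in>K. card {y\<in>K. R x y}) \<le> (\<Sum>x\<in>K. card K - 1)"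
      by (intro sum_mono)
    then show ?thesis
      using fK by simp
  qed
  finally show ?thesis
    by simp
qed

text \<open>A maximum clique, of size \<open>k\<close>, is removed. The rest again has no clique
  larger than \<open>k\<close>, so the induction hypothesis is used with \<open>k\<close> in place
  of \<open>r\<close>; since \<open>k \<le> r\<close>, the bound for \<open>k\<close> implies the
  one for \<open>r\<close>.\<close>

lemma turan_bound:
  assumes "finite S" "\<And>x y. R x y \<Longrightarrow> R y x" "\<And>x. \<not> R x x"
    and "\<And>K. K \<subseteq> S \<Longrightarrow> clique R K \<Longrightarrow> card K \<le> r"
  shows "r * card (arcs R S) \<le> (r - 1) * (card S)^2"
  using assms(1,4)
proof (induction S arbitrary: r rule: finite_psubset_induct)
  case (psubset S)
  show ?case
  proof (cases "S = {}")
    case True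
    then show ?thesis by (simp add: arcs_def)
  next
    case False
    then obtain x where x: "x \<in> S" by auto
    have "clique R {}" by (simp add: clique_def)
    obtain K where K: "K \<subseteq> S" "clique R K"
      and Kmax': "\<forall>K'\<subseteq>S. clique R K' \<longrightarrow> card K' \<le> card K"
      using ex_max_card[of S "clique R", OF psubset.hyps \<open>clique R {}\<close> empty_subsetI] .
    have Kmax: "card K' \<le> card K" if "K' \<subseteq> S" "clique R K'" for K'
      using Kmax' that by blast
    define k where "k = card K"
    have fK: "finite K"
      using K psubset.hyps finite_subset by blast
    have "card {x} \<le> k"
      unfolding k_def using x by (intro Kmax) (auto simp: clique_def)
    then have k1: "k \<ge> 1" by simp
    have kr: "k \<le> r"
      using psubset.prems[OF K] by (simp add: k_def)
    have ks: "k \<le> card S"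
      using K psubset.hyps by (simp add: k_def card_mono)
    have "K \<noteq> {}" using k1 by (auto simp: k_def)
    then have sub: "S - K \<subset> S" using K by auto
    have IH: "k * card (arcs R (S - K)) \<le> (k - 1) * (card (S - K))^2"
      using psubset.IH[OF sub, of k] Kmax unfolding k_def by blast
    have few: "card {y\<in>K. R z y} \<le> card K - 1" if z: "z \<in> S - K" for z
    proof -
      have "\<exists>y\<in>K. \<not> R z y"
      proof (rule ccontr)
        assume "\<not> (\<exists>y\<in>K. \<not> R z y)"
        then have "clique R (insert z K)"
          using K(2) assms(2) by (auto simp: clique_def)
        then have "card (insert z K) \<le> card K"
          using z K by (intro Kmax) auto
        then show False
          using z fK by auto
      qed
      then obtain y where "y \<in> K" "\<not> R z y" by auto
      then have "card {y\<in>K. R z y} \<le> card (K - {y})"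
        using fK by (intro card_mono) auto
      then show ?thesis
        using fK \<open>y \<in> K\<close> by simp
    qed
    obtain j where j: "k = Suc j" using k1 by (cases k) auto
    obtain t where t: "card S = k + t" using ks le_Suc_ex by blast
    have cSK: "card (S - K) = t"
      using K fK t by (simp add: card_Diff_subset k_def)
    have "card (arcs R S) \<le> card (arcs R (S - K)) + k * j + 2 * t * j"
      using card_arcs_diff_clique[OF psubset.hyps K(1) assms(2,3) few] j t
      by (simp add: k_def[symmetric])
    then have "k * card (arcs R S) \<le> k * (card (arcs R (S - K)) + k * j + 2 * t * j)"
      by (rule mult_le_mono2)
    also have "\<dots> \<le> j * t^2 + k * (k * j + 2 * t * j)"
      using IH cSK j by (simp add: algebra_simps)
    also have "\<dots> = j * (card S)^2"
      by (simp add: t power2_eq_square algebra_simps)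
    finally have *: "k * card (arcs R S) \<le> j * (card S)^2" .
    have "k * (r * card (arcs R S)) \<le> r * (j * (card S)^2)"
      using mult_le_mono2[OF *, of r] by (simp add: algebra_simps)
    also have "\<dots> \<le> k * ((r - 1) * (card S)^2)"
    proof -
      have "r * j \<le> k * (r - 1)"
        using kr k1 j by (cases r) auto
      then show ?thesis
        using mult_le_mono1 by (metis mult.assoc)
    qed
    finally show ?thesis
      using k1 by simp
  qed
qed

text \<open>Removing an edge of \<open>B\<close> lowers the count by at most \<open>card K + card B\<close>, since its ends have
  no common neighbour, and it lowers \<open>card Q\<close>.\<close>

lemma triangle_free_arcs_bound:
  assumes "finite K" "finite B" "\<And>x y. R x y \<Longrightarrow> R y x"
    and "K \<inter> B = {}" "indep R K" "Q \<subseteq> B" "indep R (B - Q)"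
    and "\<And>x y z. x \<in> K \<union> B \<Longrightarrow> y \<in> K \<union> B \<Longrightarrow> z \<in> K \<union> B \<Longrightarrow> R x y \<Longrightarrow> R y z \<Longrightarrow> \<not> R x z"
  shows "card (arcs R (K \<union> B)) \<le> 2 * (card K * card B + card Q * (card B - card K))"
  using assms(2,4,6-8)
proof (induction B arbitrary: Q rule: finite_psubset_induct)
  case (psubset B)
  have fS: "finite (K \<union> B)" using assms(1) psubset.hyps by auto
  show ?case
  proof (cases "indep R B")
    case True
    have "arcs R (K \<union> B) \<subseteq> K \<times> B \<union> B \<times> K"
      using True assms(5) by (auto simp: arcs_def indep_def)
    then have "card (arcs R (K \<union> B)) \<le> card (K \<times> B \<union> B \<times> K)"
      using assms(1) psubset.hyps by (intro card_mono) auto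
    also have "\<dots> \<le> card (K \<times> B) + card (B \<times> K)"
      by (rule card_Un_le)
    finally show ?thesis
      by (simp add: card_cartesian_product algebra_simps)
  next
    case False
    then obtain q q' where q: "q \<in> B" "q' \<in> B" "R q q'"
      by (auto simp: indep_def)
    have "q \<in> Q \<or> q' \<in> Q"
      using q psubset.prems(3) by (auto simp: indep_def)
    have ne: "q \<noteq> q'"
      using psubset.prems(4)[of q q q] q by auto
    define B' where "B' = B - {q, q'}"
    define Q' where "Q' = Q - {q, q'}"
    have fQ: "finite Q" using psubset.hyps psubset.prems(2) by (metis finite_subset)
    have cB: "card B = card B' + 2"
    proof -
      have "card (B - {q, q'}) = card B - card {q, q'}"
        using q by (intro card_Diff_subset) auto
      moreover have "card {q, q'} \<le> card B"
        using q psubset.hyps by (intro card_mono) auto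
      ultimately show ?thesis using ne by (simp add: B'_def)
    qed
    have "card Q' < card Q"
      unfolding Q'_def using fQ \<open>q \<in> Q \<or> q' \<in> Q\<close> by (intro psubset_card_mono) auto
    then obtain j where j: "card Q = Suc j" "card Q' \<le> j"
      by (cases "card Q") auto
    have IH: "card (arcs R (K \<union> B')) \<le> 2 * (card K * card B' + card Q' * (card B' - card K))"
    proof (rule psubset.IH)
      show "B' \<subset> B" using q by (auto simp: B'_def)
      show "K \<inter> B' = {}" using psubset.prems(1) by (auto simp: B'_def)
      show "Q' \<subseteq> B'" using psubset.prems(2) by (auto simp: B'_def Q'_def)
      show "indep R (B' - Q')" using psubset.prems(3) by (auto simp: indep_def B'_def Q'_def)
      show "\<not> R x z" if "x \<in> K \<union> B'" "y \<in> K \<union> B'" "z \<in> K \<union> B'" "R x y" "R y z" for x y z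
        using that by (intro psubset.prems(4)[of x y z]) (auto simp: B'_def)
    qed
    let ?N = "\<lambda>x. {y \<in> K \<union> B. R x y}"
    have "?N q \<inter> ?N q' = {}"
    proof -
      have "\<not> R q z" if "z \<in> K \<union> B" "R q' z" for z
        using psubset.prems(4)[of q q' z] q that by blast
      then show ?thesis by auto
    qed
    then have "card (?N q) + card (?N q') = card (?N q \<union> ?N q')"
      using fS by (subst card_Un_disjoint) auto
    also have "\<dots> \<le> card (K \<union> B)"
      using fS by (intro card_mono) auto
    also have "\<dots> \<le> card K + card B"
      by (rule card_Un_le)
    finally have deg: "card (?N q) + card (?N q') \<le> card K + card B" .
    have "q \<notin> K" "q' \<notin> K" using q psubset.prems(1) by auto
    have "arcs R (K \<union> B) \<subseteq> arcs R (K \<union> B') \<union>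
        (({q} \<times> ?N q \<union> ?N q \<times> {q}) \<union> ({q'} \<times> ?N q' \<union> ?N q' \<times> {q'}))"
    proof
      fix e assume "e \<in> arcs R (K \<union> B)"
      then obtain x y where e: "e = (x, y)" "x \<in> K \<union> B" "y \<in> K \<union> B" "R x y"
        by (auto simp: arcs_def)
      then show "e \<in> arcs R (K \<union> B') \<union>
          (({q} \<times> ?N q \<union> ?N q \<times> {q}) \<union> ({q'} \<times> ?N q' \<union> ?N q' \<times> {q'}))"
        using assms(3)[OF e(4)] \<open>q \<notin> K\<close> \<open>q' \<notin> K\<close> by (auto simp: arcs_def B'_def)
    qed
    then have "card (arcs R (K \<union> B)) \<le> card (arcs R (K \<union> B') \<union>
        (({q} \<times> ?N q \<union> ?N q \<times> {q}) \<union> ({q'} \<times> ?N q' \<union> ?N q' \<times> {q'})))"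
      using fS by (intro card_mono) (auto simp: finite_arcs B'_def)
    also have "\<dots> \<le> card (arcs R (K \<union> B')) +
        ((card ({q} \<times> ?N q) + card (?N q \<times> {q})) + (card ({q'} \<times> ?N q') + card (?N q' \<times> {q'})))"
      by (meson add_mono card_Un_le le_trans order_refl)
    also have "\<dots> \<le> card (arcs R (K \<union> B')) + 2 * (card K + card B)"
      using deg by (simp add: card_cartesian_product)
    also have "\<dots> \<le> 2 * (card K * card B' + j * (card B' - card K)) + 2 * (card K + card B)"
      by (rule add_right_mono, rule order.trans[OF IH])
        (use mult_le_mono1[OF j(2), of "card B' - card K"] in simp)
    also have "\<dots> \<le> 2 * (card K * card B + card Q * (card B - card K))"
    proof -
      have "j * (card B' - card K) \<le> j * (card B - card K)"
        using cB by (intro mult_le_mono2) auto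
      moreover have "card K * card B = card K * card B' + 2 * card K"
        by (simp add: cB)
      moreover have "card Q * (card B - card K) = j * (card B - card K) + (card B - card K)"
        by (simp add: j)
      \<comment> \<open>Subtraction is truncated, so this also covers the case that \<open>B\<close>
        is smaller than \<open>K\<close>.\<close>
      moreover have "card K + card B \<le> 2 * card K + (card B - card K)"
        by simp
      moreover have "2 * (p' + s') + 2 * w \<le> 2 * (p + s)"
        if "s' \<le> t" "p = p' + u" "s = t + v" "w \<le> u + v" for p p' s s' t u v w :: nat
        using that by simp
      ultimately show ?thesis by blast
    qed
    finally show ?thesis .
  qed
qed

text \<open>Summed over all arcs, the degree sum of the two ends is twice the sum of the squared
  degrees. By Cauchy-Schwarz an average arc satisfies the bound.\<close>

lemma ex_arc_large_degree_sum:
  assumes "finite S" "\<And>x y. R x y \<Longrightarrow> R y x" "arcs R S \<noteq> {}"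
  obtains x y where "x \<in> S" "y \<in> S" "R x y"
    "2 * card (arcs R S) \<le> (card {z\<in>S. R x z} + card {z\<in>S. R y z}) * card S"
proof -
  let ?f = "\<lambda>x. real (card {z\<in>S. R x z})"
  let ?A = "real (card (arcs R S))"
  have A: "?A = (\<Sum>x\<in>S. ?f x)"
    using card_arcs[OF assms(1), of R] by simp
  have sym: "R x y = R y x" for x y
    using assms(2) by blast
  have sig: "arcs R S = (SIGMA x:S. {y\<in>S. R x y})"
    by (auto simp: arcs_def)
  have "(\<Sum>(x,y)\<in>arcs R S. ?f x + ?f y) = (\<Sum>x\<in>S. \<Sum>y | y \<in> S \<and> R x y. ?f x + ?f y)"
    unfolding sig using assms(1) by (subst sum.Sigma) auto
  also have "\<dots> = (\<Sum>x\<in>S. \<Sum>y | y \<in> S \<and> R x y. ?f x) + (\<Sum>x\<in>S. \<Sum>y | y \<in> S \<and> R x y. ?f y)"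
    by (simp add: sum.distrib)
  also have "(\<Sum>x\<in>S. \<Sum>y | y \<in> S \<and> R x y. ?f y) = (\<Sum>y\<in>S. \<Sum>x | x \<in> S \<and> R x y. ?f y)"
    using assms(1) by (intro sum.swap_restrict)
  also have "\<dots> = (\<Sum>y\<in>S. \<Sum>x | x \<in> S \<and> R y x. ?f y)"
    by (intro sum.cong refl) (metis (no_types, lifting) sym)
  finally have eq: "(\<Sum>(x,y)\<in>arcs R S. ?f x + ?f y) = 2 * (\<Sum>x\<in>S. (?f x)^2)"
    by (simp add: power2_eq_square)
  have CS: "?A^2 \<le> (\<Sum>x\<in>S. (?f x)^2) * real (card S)"
  proof -
    have "0 \<le> (\<Sum>x\<in>S. (real (card S) * ?f x - ?A)^2)"
      by (intro sum_nonneg) auto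
    also have "\<dots> = (\<Sum>x\<in>S. (real (card S))^2 * (?f x)^2 - 2 * real (card S) * ?A * ?f x + ?A^2)"
      by (intro sum.cong) (auto simp: power2_eq_square algebra_simps)
    also have "\<dots> = (real (card S))^2 * (\<Sum>x\<in>S. (?f x)^2) - 2 * real (card S) * ?A * ?A + real (card S) * ?A^2"
      by (simp add: sum.distrib sum_subtractf sum_distrib_left[symmetric] A)
    also have "\<dots> = real (card S) * (real (card S) * (\<Sum>x\<in>S. (?f x)^2) - ?A^2)"
      by (simp add: power2_eq_square algebra_simps)
    finally have "0 \<le> real (card S) * (real (card S) * (\<Sum>x\<in>S. (?f x)^2) - ?A^2)" .
    moreover have "card S > 0"
      using assms(1,3) by (auto simp: arcs_def card_gt_0_iff)
    ultimately show ?thesis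
      by (simp add: zero_le_mult_iff mult.commute)
  qed
  have "\<exists>(x,y)\<in>arcs R S. 2 * ?A \<le> (?f x + ?f y) * real (card S)"
  proof (rule ccontr)
    assume "\<not> ?thesis"
    then have "(\<Sum>(x,y)\<in>arcs R S. (?f x + ?f y) * real (card S)) < (\<Sum>(x,y)\<in>arcs R S. 2 * ?A)"
      using assms by (intro sum_strict_mono) (auto simp: finite_arcs)
    also have "\<dots> = 2 * ?A^2"
      by (simp add: power2_eq_square case_prod_unfold)
    also have "(\<Sum>(x,y)\<in>arcs R S. (?f x + ?f y) * real (card S)) = 2 * (\<Sum>x\<in>S. (?f x)^2) * real (card S)"
      unfolding eq[symmetric] by (simp add: sum_distrib_right case_prod_unfold)
    finally show False
      using CS by simp
  qed
  then obtain x y where xy: "x \<in> S" "y \<in> S" "R x y"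
    and "2 * ?A \<le> (?f x + ?f y) * real (card S)"
    by (auto simp: arcs_def)
  then have "real (2 * card (arcs R S)) \<le> real ((card {z\<in>S. R x z} + card {z\<in>S. R y z}) * card S)"
    by simp
  then show thesis
    using that[OF xy] by linarith
qed

lemma of_bool_cycle5:
  assumes "\<not> (a \<and> b)" "\<not> (b \<and> c)" "\<not> (c \<and> d)" "\<not> (d \<and> e)" "\<not> (e \<and> a)"
  shows "of_bool a + of_bool b + of_bool c + of_bool d + of_bool e \<le> (2::real)"
  using assms by (cases a; cases b; cases c; cases d; cases e) simp_all

section \<open>Dense graphs without complete subgraphs on four vertices\<close>

text \<open>This isolates what is kept of the 3-graph: its shadow, and for each vertex the number of
  adjacent pairs in its neighbourhood, where the pairs of its link are found.\<close>

locale dense_k4_free =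
  fixes V :: "'a set" and adj :: "'a \<Rightarrow> 'a \<Rightarrow> bool"
  assumes finite_V: "finite V"
    and adj_V: "adj u v \<Longrightarrow> u \<in> V"
    and adj_sym: "adj u v \<Longrightarrow> adj v u"
    and adj_irrefl: "\<not> adj v v"
    and k4_free: "adj a b \<Longrightarrow> adj a c \<Longrightarrow> adj a d \<Longrightarrow> adj b c \<Longrightarrow> adj b d \<Longrightarrow> \<not> adj c d"
    and dense: "v \<in> V \<Longrightarrow> 8 / 45 * real (card V)^2 < real (card (arcs adj {u. adj v u}))"
begin

definition nb :: "'a \<Rightarrow> 'a set" where
  "nb v = {u. adj v u}"

definition m :: "'a set \<Rightarrow> real" where
  "m S = real (card S) / real (card V)"

lemma mem_nb [simp]: "u \<in> nb v \<longleftrightarrow> adj v u"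
  by (simp add: nb_def)

lemma adj_commute: "adj u v \<longleftrightarrow> adj v u"
  using adj_sym by blast

lemma nb_subset: "nb v \<subseteq> V"
  using adj_V[OF adj_sym] by auto

lemma finite_sub: "S \<subseteq> V \<Longrightarrow> finite S"
  using finite_V finite_subset by blast

lemma finite_nb: "finite (nb v)"
  using finite_sub nb_subset by blast

lemma m_nonneg [simp]: "0 \<le> m S"
  by (simp add: m_def)

lemma m_empty [simp]: "m {} = 0"
  by (simp add: m_def)

lemma m_mono: "A \<subseteq> B \<Longrightarrow> B \<subseteq> V \<Longrightarrow> m A \<le> m B"
  unfolding m_def by (intro divide_right_mono) (auto intro!: card_mono finite_sub)

lemma m_Un: "A \<subseteq> V \<Longrightarrow> B \<subseteq> V \<Longrightarrow> A \<inter> B = {} \<Longrightarrow> m (A \<union> B) = m A + m B"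
  unfolding m_def by (simp add: card_Un_disjoint finite_sub add_divide_distrib)

lemma m_Int_Diff: "A \<subseteq> V \<Longrightarrow> m A = m (A \<inter> B) + m (A - B)"
proof -
  assume "A \<subseteq> V"
  then have "m ((A \<inter> B) \<union> (A - B)) = m (A \<inter> B) + m (A - B)"
    by (intro m_Un) auto
  then show ?thesis
    by (simp add: Int_Diff_Un)
qed

lemma m_V: "v \<in> V \<Longrightarrow> m V = 1"
  using finite_V by (auto simp: m_def)

lemma m_compl: "v \<in> V \<Longrightarrow> S \<subseteq> V \<Longrightarrow> m (V - S) = 1 - m S"
  using m_Int_Diff[of V S] m_V by (simp add: Int_absorb1)

lemma m_Un_le: "A \<subseteq> V \<Longrightarrow> B \<subseteq> V \<Longrightarrow> m (A \<union> B) \<le> m A + m B"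
  using m_Un[of A "B - A"] m_mono[of "B - A" B] by (simp add: Un_Diff_cancel subset_iff)

lemma card_V_pos: "v \<in> V \<Longrightarrow> real (card V) > 0"
  using finite_V by (auto simp: card_gt_0_iff)

lemma common_nb_indep: "adj u v \<Longrightarrow> indep adj (nb u \<inter> nb v)"
  using k4_free[of u v] unfolding indep_def by (metis Int_iff mem_nb)

text \<open>The constant is a rational number just below the square root of \<open>16/45\<close>.\<close>

lemma min_degree:
  assumes "v \<in> V"
  shows "149 / 250 < m (nb v)"
proof -
  have "card K \<le> 2" if K: "K \<subseteq> nb v" "clique adj K" for K
  proof (rule ccontr)
    assume "\<not> card K \<le> 2"
    then obtain T where "T \<subseteq> K" "card T = 3"
      by (metis not_less_eq_eq numeral_2_eq_2 numeral_3_eq_3 obtain_subset_with_card_n)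
    then obtain x y z where "{x, y, z} \<subseteq> K" "x \<noteq> y" "y \<noteq> z" "x \<noteq> z"
      by (auto simp: card_3_iff)
    moreover from this K have "adj v x" "adj v y" "adj v z"
      by auto
    ultimately show False
      using K(2) k4_free[of v x y z] by (auto simp: clique_def)
  qed
  then have "2 * card (arcs adj (nb v)) \<le> (2 - 1) * (card (nb v))^2"
    by (intro turan_bound finite_nb adj_irrefl) (auto intro: adj_sym)
  then have "2 * card (arcs adj (nb v)) \<le> (card (nb v))^2"
    by simp
  then have "2 * real (card (arcs adj (nb v))) \<le> real (card (nb v))^2"
    by (metis of_nat_le_iff of_nat_mult of_nat_numeral of_nat_power)
  then have "16 / 45 * real (card V)^2 < real (card (nb v))^2"
    using dense[OF assms] by (simp add: nb_def)
  moreover have "(149 / 250 * real (card V))^2 \<le> 16 / 45 * real (card V)^2"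
    unfolding power_mult_distrib by (rule mult_right_mono) (simp_all add: power2_eq_square)
  ultimately have "(149 / 250 * real (card V))^2 < real (card (nb v))^2"
    by linarith
  then have "149 / 250 * real (card V) < real (card (nb v))"
    by (rule power2_less_imp_less) simp
  then show ?thesis
    using card_V_pos[OF assms] by (simp add: m_def field_simps)
qed

lemma disjoint_nb_small:
  assumes "v \<in> V" "S \<subseteq> V" "S \<inter> nb v = {}"
  shows "m S < 101 / 250"
proof -
  have "m S \<le> m (V - nb v)"
    using assms by (intro m_mono) auto
  then show ?thesis
    using min_degree[OF assms(1)] m_compl[OF assms(1) nb_subset] by (simp add: algebra_simps)
qed

lemma indep_small:
  assumes "S \<subseteq> V" "indep adj S"
  shows "m S < 101 / 250"
proof (cases "S = {}")
  case False
  then obtain v where "v \<in> S" by auto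
  then show ?thesis
    using assms by (intro disjoint_nb_small[of v S]) (auto simp: indep_def)
qed simp

lemma m_nb_Int:
  assumes "S \<subseteq> V"
  shows "m (nb c \<inter> S) = (\<Sum>p\<in>S. of_bool (adj c p)) / real (card V)"
  using assms by (simp add: m_def nb_def sum_of_bool_eq finite_sub Int_commute)

lemma m_sum5_le:
  assumes "S \<subseteq> V"
    and "\<And>p. p \<in> S \<Longrightarrow> of_bool (adj c1 p) + of_bool (adj c2 p) + of_bool (adj c3 p)
            + of_bool (adj c4 p) + of_bool (adj c5 p) \<le> (k::real)"
  shows "m (nb c1 \<inter> S) + m (nb c2 \<inter> S) + m (nb c3 \<inter> S) + m (nb c4 \<inter> S) + m (nb c5 \<inter> S) \<le> k * m S"
proof -
  have "(\<Sum>p\<in>S. of_bool (adj c1 p) + of_bool (adj c2 p) + of_bool (adj c3 p)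
            + of_bool (adj c4 p) + of_bool (adj c5 p)) \<le> (\<Sum>p\<in>S. k)"
    using assms(2) by (rule sum_mono)
  then have "((\<Sum>p\<in>S. of_bool (adj c1 p)) + (\<Sum>p\<in>S. of_bool (adj c2 p)) + (\<Sum>p\<in>S. of_bool (adj c3 p))
            + (\<Sum>p\<in>S. of_bool (adj c4 p)) + (\<Sum>p\<in>S. of_bool (adj c5 p))) / real (card V)
            \<le> k * real (card S) / real (card V)"
    by (intro divide_right_mono) (auto simp: sum.distrib mult.commute)
  then show ?thesis
    unfolding m_nb_Int[OF assms(1)] by (simp add: m_def add_divide_distrib)
qed

text \<open>The vertices of a pentagon need not be distinct.\<close>

definition pentagon :: "'a \<Rightarrow> 'a \<Rightarrow> 'a \<Rightarrow> 'a \<Rightarrow> 'a \<Rightarrow> bool" where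
  "pentagon c1 c2 c3 c4 c5 \<longleftrightarrow> adj c1 c2 \<and> adj c2 c3 \<and> adj c3 c4 \<and> adj c4 c5 \<and> adj c5 c1"

text \<open>In a triangle-free set no vertex sees two consecutive vertices of the pentagon, hence it
  sees at most two of the five.\<close>

lemma pentagon_degree_sum:
  assumes "pentagon c1 c2 c3 c4 c5" "{c1, c2, c3, c4, c5} \<subseteq> S" "S \<subseteq> V"
    and tf: "\<And>x y z. x \<in> S \<Longrightarrow> y \<in> S \<Longrightarrow> z \<in> S \<Longrightarrow> adj x y \<Longrightarrow> adj y z \<Longrightarrow> \<not> adj x z"
  shows "m (nb c1 \<inter> S) + m (nb c2 \<inter> S) + m (nb c3 \<inter> S) + m (nb c4 \<inter> S) + m (nb c5 \<inter> S) \<le> 2 * m S"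
proof (rule m_sum5_le[OF assms(3)])
  fix p assume p: "p \<in> S"
  have no: "\<not> (adj x p \<and> adj y p)" if "adj x y" "x \<in> S" "y \<in> S" for x y
    using tf[of x y p] that p by blast
  show "of_bool (adj c1 p) + of_bool (adj c2 p) + of_bool (adj c3 p)
            + of_bool (adj c4 p) + of_bool (adj c5 p) \<le> (2::real)"
    using assms(1,2) unfolding pentagon_def by (intro of_bool_cycle5 no) simp_all
qed

end

lemma ex_maximal_indep:
  assumes "finite S" "A \<subseteq> S" "indep R A" "\<And>x y. R x y \<Longrightarrow> R y x" "\<And>x. \<not> R x x"
  obtains I where "A \<subseteq> I" "I \<subseteq> S" "indep R I" "\<forall>c\<in>S - I. \<exists>g\<in>I. R c g"
proof -
  have A: "A \<subseteq> A \<and> indep R A"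
    using assms(3) by simp
  obtain I where I: "I \<subseteq> S" "A \<subseteq> I \<and> indep R I"
    and max: "\<forall>I'\<subseteq>S. A \<subseteq> I' \<and> indep R I' \<longrightarrow> card I' \<le> card I"
    using ex_max_card[of S "\<lambda>I. A \<subseteq> I \<and> indep R I", OF assms(1) A assms(2)] .
  have "\<exists>g\<in>I. R c g" if c: "c \<in> S - I" for c
  proof (rule ccontr)
    assume no: "\<not> (\<exists>g\<in>I. R c g)"
    then have "indep R (insert c I)"
      using I(2) assms(4)[of _ c] assms(5)[of c] unfolding indep_def by auto
    then have "card (insert c I) \<le> card I"
      using I c max by (metis Diff_iff insert_subset subset_insertI2)
    moreover have "finite I"
      using I assms(1) finite_subset by blast
    ultimately show False
      using c by simp
  qed
  then show thesis
    using that[of I] I by simp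
qed

section \<open>Dense common neighbourhoods\<close>

context dense_k4_free
begin

lemma m_Int_ge:
  assumes "v \<in> V" "A \<subseteq> V" "B \<subseteq> V"
  shows "m A + m B - 1 \<le> m (A \<inter> B)"
proof -
  have "m (A - B) \<le> m (V - B)"
    using assms by (intro m_mono) auto
  then show ?thesis
    using m_Int_Diff[OF assms(2), of B] m_compl[OF assms(1,3)] by simp
qed

text \<open>If all these densities were at most 53/250, then
  \<open>m (nb v) + m (nb x) - 1 \<le> 53/250\<close> would force \<open>m (nb v) < 154/250\<close>,
  and \<open>nb v\<close> would span at most \<open>154/250 * 53/250 * n^2\<close> arcs, fewer than
  \<open>8/45 * n^2\<close>.\<close>

lemma ex_large_common_nb:
  assumes "v \<in> V"
  obtains x where "adj v x" "53 / 250 < m (nb v \<inter> nb x)"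
proof (rule ccontr)
  assume "\<not> thesis"
  then have small: "m (nb v \<inter> nb x) \<le> 53 / 250" if "adj v x" for x
    using that \<open>\<And>x. adj v x \<Longrightarrow> 53 / 250 < m (nb v \<inter> nb x) \<Longrightarrow> thesis\<close> by force
  have "nb v \<noteq> {}"
    using min_degree[OF assms] by auto
  then obtain x where x: "adj v x" by auto
  then have "x \<in> V" using adj_V adj_sym by blast
  have d: "m (nb v) < 154 / 250"
    using small[OF x] m_Int_ge[OF assms nb_subset[of v] nb_subset[of x]] min_degree[OF \<open>x \<in> V\<close>]
    by simp
  let ?n = "real (card V)"
  note n = card_V_pos[OF assms]
  have "real (card (arcs adj (nb v))) = (\<Sum>x\<in>nb v. real (card {y\<in>nb v. adj x y}))"
    using card_arcs[OF finite_nb] by simp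
  also have "\<dots> \<le> (\<Sum>x\<in>nb v. 53 / 250 * ?n)"
  proof (rule sum_mono)
    fix x assume "x \<in> nb v"
    moreover have "{y\<in>nb v. adj x y} = nb v \<inter> nb x" by auto
    ultimately show "real (card {y\<in>nb v. adj x y}) \<le> 53 / 250 * ?n"
      using small[of x] n by (simp add: m_def field_simps)
  qed
  also have "\<dots> = m (nb v) * (53 / 250 * ?n^2)"
    using n by (simp add: m_def power2_eq_square)
  also have "\<dots> \<le> 154 / 250 * (53 / 250 * ?n^2)"
    using d by (intro mult_right_mono) auto
  also have "\<dots> \<le> 8 / 45 * ?n^2"
    by simp
  finally show False
    using dense[OF assms] by (simp add: nb_def)
qed

text \<open>No vertex is adjacent to all of \<open>x\<close>, \<open>y\<close>, \<open>z\<close>, so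
  the three common neighbourhoods are disjoint. The degree sum of the triangle counts their members
  twice and all other vertices at most once, which leaves more than \<open>3 * 149/250 - 1\<close>
  for them.\<close>

lemma triangle_cover:
  assumes "adj x y" "adj y z" "adj x z"
  shows "197 / 250 < m (nb y \<inter> nb z) + m (nb x \<inter> nb z) + m (nb x \<inter> nb y)"
    and "m ((nb y \<inter> nb z) \<union> (nb x \<inter> nb z) \<union> (nb x \<inter> nb y))
      = m (nb y \<inter> nb z) + m (nb x \<inter> nb z) + m (nb x \<inter> nb y)"
proof -
  have V: "x \<in> V" "y \<in> V" "z \<in> V"
    using assms adj_V adj_sym by blast+
  let ?P = "nb y \<inter> nb z" and ?Q = "nb x \<inter> nb z" and ?R = "nb x \<inter> nb y"
  have sub: "?P \<subseteq> V" "?Q \<subseteq> V" "?R \<subseteq> V" "?P \<union> ?Q \<subseteq> V"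
    using nb_subset by blast+
  have no: "\<not> (adj x p \<and> adj y p \<and> adj z p)" for p
    using k4_free[of x y z p] assms by blast
  have "m (?P \<union> ?Q) = m ?P + m ?Q" "m (?P \<union> ?Q \<union> ?R) = m (?P \<union> ?Q) + m ?R"
    using no sub by (auto intro!: m_Un)
  then show un: "m (?P \<union> ?Q \<union> ?R) = m ?P + m ?Q + m ?R"
    by simp
  have "m (nb x) = m (nb x \<inter> nb y) + m (nb x - nb y)"
    by (rule m_Int_Diff[OF nb_subset])
  moreover have "m (nb x - nb y) = m ((nb x - nb y) \<inter> nb z) + m (nb x - nb y - nb z)"
    using nb_subset by (intro m_Int_Diff) blast
  moreover have "(nb x - nb y) \<inter> nb z = ?Q"
    using no by auto
  moreover have "m (nb y \<union> nb z) = m (nb y) + m (nb z) - m ?P"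
  proof -
    have "m (nb y \<union> (nb z - nb y)) = m (nb y) + m (nb z - nb y)"
      using nb_subset by (intro m_Un) blast+
    then show ?thesis
      using m_Int_Diff[OF nb_subset, of z "nb y"] by (simp add: Int_commute)
  qed
  moreover have "m (nb y \<union> nb z) + m (nb x - nb y - nb z) = m ((nb y \<union> nb z) \<union> (nb x - nb y - nb z))"
    using nb_subset by (intro m_Un[symmetric]) blast+
  moreover have "m ((nb y \<union> nb z) \<union> (nb x - nb y - nb z)) \<le> m V"
    using nb_subset by (intro m_mono) blast+
  ultimately show "197 / 250 < m ?P + m ?Q + m ?R"
    using min_degree[OF V(1)] min_degree[OF V(2)] min_degree[OF V(3)] m_V[OF V(1)] by simp
qed

section \<open>Three-colouring when no neighbourhood contains a pentagon\<close>

context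
  assumes no_wheel: "\<And>a c1 c2 c3 c4 c5. pentagon c1 c2 c3 c4 c5 \<Longrightarrow> \<not> {c1, c2, c3, c4, c5} \<subseteq> nb a"
begin

text \<open>A common neighbour of \<open>u\<close> and \<open>w\<close> in \<open>N(z)\<close> would close the path \<open>u y x w\<close> to a pentagon there.\<close>

lemma indep_meets_one_side:
  assumes I: "I \<subseteq> V" "indep adj I" "53 / 250 < m I"
    and xyz: "adj x y" "adj y z" "adj x z"
    and u: "u \<in> I" "adj y u" "adj z u" and w: "w \<in> I" "adj x w" "adj z w"
  shows False
proof -
  have V: "z \<in> V" "u \<in> V" "w \<in> V"
    using assms adj_V adj_sym by blast+
  have no: "\<not> (adj z k \<and> adj u k \<and> adj w k)" for k
  proof
    assume k: "adj z k \<and> adj u k \<and> adj w k"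
    then have "pentagon u y x w k"
      using xyz u w adj_sym unfolding pentagon_def by blast
    then show False
      using no_wheel[of u y x w k z] k adj_sym[OF xyz(2)] adj_sym[OF xyz(3)] u w by simp
  qed
  \<comment> \<open>A neighbour of \<open>z\<close> misses \<open>u\<close> or \<open>w\<close>, and
    one adjacent to \<open>u\<close> lies outside the independent set \<open>I\<close>. As
    \<open>I\<close> itself lies in \<open>V - nb w\<close>, the right side has density at most
    \<open>2 - m (nb u) - m (nb w) - m I\<close>; three degrees above 149/250 then force
    \<open>m I < 53/250\<close>.\<close>
  have "nb z \<subseteq> (V - nb u) \<union> (V - nb w - I)"
    using no nb_subset[of z] I(2) u unfolding indep_def by fastforce
  then have "m (nb z) \<le> m ((V - nb u) \<union> (V - nb w - I))"
    by (rule m_mono) auto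
  also have "\<dots> \<le> m (V - nb u) + m (V - nb w - I)"
    by (rule m_Un_le) auto
  also have "m (V - nb w - I) = m (V - nb w) - m I"
  proof -
    have "(V - nb w) \<inter> I = I"
      using I w unfolding indep_def by auto
    then show ?thesis
      using m_Int_Diff[of "V - nb w" I] by simp
  qed
  finally show False
    using min_degree[OF V(1)] min_degree[OF V(2)] min_degree[OF V(3)] I(3)
      m_compl[OF V(1) nb_subset, of u] m_compl[OF V(1) nb_subset, of w] by simp
qed

lemma indep_meets_side:
  assumes I: "I \<subseteq> V" "53 / 250 < m I"
    and xyz: "adj x y" "adj y z" "adj x z"
  shows "I \<inter> ((nb y \<inter> nb z) \<union> (nb x \<inter> nb z) \<union> (nb x \<inter> nb y)) \<noteq> {}"
proof
  let ?S = "(nb y \<inter> nb z) \<union> (nb x \<inter> nb z) \<union> (nb x \<inter> nb y)"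
  assume "I \<inter> ?S = {}"
  then have "m (I \<union> ?S) = m I + m ?S"
    using I nb_subset by (intro m_Un) blast+
  moreover have "m (I \<union> ?S) \<le> m V"
    using I nb_subset by (intro m_mono) blast+
  ultimately show False
    using triangle_cover[OF xyz] I m_V[OF adj_V[OF xyz(1)]] by simp
qed

text \<open>By maximality \<open>x\<close> has a neighbour \<open>g\<close> in \<open>I\<close>. If
  \<open>g\<close> saw nothing of \<open>nb x \<inter> nb z\<close>, whose density exceeds 48/250,
  it would be non-adjacent to this set and to \<open>I\<close>, together more than
  \<open>48/250 + 53/250 = 101/250\<close>. So \<open>g\<close> has a neighbour \<open>q\<close>
  there, likewise a neighbour \<open>r\<close> in \<open>nb x \<inter> nb y\<close>, and
  \<open>y z q g r\<close> is a pentagon inside \<open>nb x\<close>.\<close>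

lemma maximal_indep_no_wheel_side:
  assumes I: "I \<subseteq> V" "indep adj I" "53 / 250 < m I"
    and max: "\<forall>c\<in>V - I. \<exists>g\<in>I. adj c g"
    and x: "x \<notin> I" and xyz: "adj x y" "adj y z" "adj x z"
    and Q: "I \<inter> (nb x \<inter> nb z) = {}" and R: "I \<inter> (nb x \<inter> nb y) = {}"
  shows False
proof -
  have V: "x \<in> V" "y \<in> V" "z \<in> V"
    using xyz adj_V adj_sym by blast+
  obtain g where g: "g \<in> I" "adj x g"
    using max V x by blast
  then have "g \<in> V" using I by blast
  have meet: "\<exists>q\<in>S. adj g q" if S: "S = nb x \<inter> nb t" "t \<in> V" "I \<inter> S = {}" for S t
  proof (rule ccontr)
    assume "\<not> (\<exists>q\<in>S. adj g q)"
    then have "(I \<union> S) \<inter> nb g = {}"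
      using I g unfolding indep_def by auto
    then have "m (I \<union> S) < 101 / 250"
      using I S nb_subset by (intro disjoint_nb_small[OF \<open>g \<in> V\<close>]) blast+
    moreover have "m (I \<union> S) = m I + m S"
      using I S nb_subset by (intro m_Un) blast+
    moreover have "m (nb x) + m (nb t) - 1 \<le> m S"
      unfolding S by (rule m_Int_ge[OF V(1) nb_subset nb_subset])
    ultimately show False
      using min_degree[OF V(1)] min_degree[OF S(2)] I(3) by simp
  qed
  obtain q where q: "q \<in> nb x \<inter> nb z" "adj g q"
    using meet[OF refl V(3) Q] by blast
  obtain r where r: "r \<in> nb x \<inter> nb y" "adj g r"
    using meet[OF refl V(2) R] by blast
  have "pentagon y z q g r"
    using q r xyz unfolding pentagon_def by (simp add: adj_commute)
  then show False
    using no_wheel[of y z q g r x] q r g xyz by simp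
qed

text \<open>Of the three common neighbourhoods of a triangle, \<open>I\<close> meets at least one by
  density and at most one by \<open>indep_meets_one_side\<close>. The vertex shared by the two pairs
  whose common neighbourhoods it misses contradicts
  \<open>maximal_indep_no_wheel_side\<close>.\<close>

lemma maximal_indep_compl_triangle_free:
  assumes I: "I \<subseteq> V" "indep adj I" "53 / 250 < m I"
    and max: "\<forall>c\<in>V - I. \<exists>g\<in>I. adj c g"
    and xyz: "x \<in> V - I" "y \<in> V - I" "z \<in> V - I" "adj x y" "adj y z"
  shows "\<not> adj x z"
proof
  assume xz: "adj x z"
  note two = indep_meets_one_side[OF I] and one = maximal_indep_no_wheel_side[OF I max]
  have s: "adj y x" "adj z y" "adj z x"
    using xyz xz adj_sym by blast+
  have xI: "x \<notin> I" "y \<notin> I" "z \<notin> I" using xyz by auto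
  consider u where "u \<in> I" "adj y u" "adj z u" | u where "u \<in> I" "adj x u" "adj z u"
    | u where "u \<in> I" "adj x u" "adj y u"
    using indep_meets_side[OF I(1,3) xyz(4,5) xz] by auto
  then show False
  proof cases
    case (1 u)
    have "I \<inter> (nb x \<inter> nb z) = {}" "I \<inter> (nb x \<inter> nb y) = {}"
      using two[OF xyz(4,5) xz 1] two[OF xz s(2) xyz(4) 1(1,3,2)] by auto
    then show False
      using one[OF xI(1) xyz(4,5) xz] by blast
  next
    case (2 u)
    have "I \<inter> (nb y \<inter> nb z) = {}" "I \<inter> (nb y \<inter> nb x) = {}"
      using two[OF s(1) xz xyz(5) 2] two[OF xyz(5) s(3) s(1) 2(1,3,2)] by auto
    then show False
      using one[OF xI(2) s(1) xz xyz(5)] by blast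
  next
    case (3 u)
    have "I \<inter> (nb z \<inter> nb y) = {}" "I \<inter> (nb z \<inter> nb x) = {}"
      using two[OF s(3) xyz(4) s(2) 3] two[OF s(2,1,3) 3(1,3,2)] by auto
    then show False
      using one[OF xI(3) s(3) xyz(4) s(2)] by blast
  qed
qed

lemma three_colouring_no_wheel:
  assumes "V \<noteq> {}"
  obtains I J where "I \<subseteq> V" "J \<subseteq> V" "I \<inter> J = {}" "indep adj I" "indep adj J" "indep adj (V - I - J)"
proof -
  obtain v where v: "v \<in> V" using assms by auto
  obtain x where x: "adj v x" "53 / 250 < m (nb v \<inter> nb x)"
    using ex_large_common_nb[OF v] .
  have sub: "nb v \<inter> nb x \<subseteq> V" using nb_subset[of v] by blast
  obtain I where I: "nb v \<inter> nb x \<subseteq> I" "I \<subseteq> V" "indep adj I"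
    and Imax: "\<forall>c\<in>V - I. \<exists>g\<in>I. adj c g"
    using ex_maximal_indep[of V "nb v \<inter> nb x" adj, OF finite_V sub common_nb_indep[OF x(1)] adj_sym adj_irrefl] .
  have mI: "53 / 250 < m I"
    using x m_mono[OF I(1,2)] by simp
  then obtain y where y: "y \<in> I" by fastforce
  have yV: "y \<in> V" using y I by blast
  obtain t where t: "adj y t" "53 / 250 < m (nb y \<inter> nb t)"
    using ex_large_common_nb[OF yV] .
  define T where "T = V - I"
  have finT: "finite T" using finite_V by (simp add: T_def)
  \<comment> \<open>Since \<open>y\<close> is in \<open>I\<close>, its neighbourhood avoids
    \<open>I\<close>; a dense common neighbourhood of \<open>y\<close> is thus an independent seed
    for \<open>J\<close> inside \<open>T\<close>.\<close>
  have sub: "nb y \<inter> nb t \<subseteq> T"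
    using nb_subset[of y] y I(3) unfolding T_def indep_def by auto
  obtain J where J: "nb y \<inter> nb t \<subseteq> J" "J \<subseteq> T" "indep adj J"
    and Jmax: "\<forall>c\<in>T - J. \<exists>g\<in>J. adj c g"
    using ex_maximal_indep[of T "nb y \<inter> nb t" adj, OF finT sub common_nb_indep[OF t(1)] adj_sym adj_irrefl] .
  have TV: "T \<subseteq> V" by (auto simp: T_def)
  have JV: "J \<subseteq> V" using J TV by blast
  have mJ: "53 / 250 < m J"
    using t m_mono[OF J(1) JV] by simp
  have mI': "m I < 101 / 250"
    by (rule indep_small[OF I(2,3)])
  have mT: "m T = 1 - m I"
    unfolding T_def by (rule m_compl[OF v I(2)])
  have tf: "\<not> adj x z" if "x \<in> T" "y \<in> T" "z \<in> T" "adj x y" "adj y z" for x y z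
    using maximal_indep_compl_triangle_free[OF I(2,3) mI Imax] that unfolding T_def by blast
  have degT: "149 / 250 < m (nb c \<inter> T) + m (nb c \<inter> I)" if "c \<in> V" for c
  proof -
    have "m (nb c) = m (nb c \<inter> I) + m (nb c - I)"
      by (rule m_Int_Diff[OF nb_subset])
    moreover have "nb c - I = nb c \<inter> T"
      using nb_subset by (auto simp: T_def)
    ultimately show ?thesis
      using min_degree[OF that] by simp
  qed
  have "indep adj (T - J)"
  proof (rule ccontr)
    assume "\<not> indep adj (T - J)"
    then obtain c c' where c: "c \<in> T - J" "c' \<in> T - J" "adj c c'"
      by (auto simp: indep_def)
    obtain j j' where j: "j \<in> J" "adj c j" "j' \<in> J" "adj c' j'"
      using Jmax c by blast
    have V: "c \<in> V" "c' \<in> V" "j \<in> V" "j' \<in> V"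
      using c j JV TV by blast+
    \<comment> \<open>Otherwise the neighbourhoods of \<open>j\<close> and \<open>j'\<close> in
      \<open>T\<close> are disjoint subsets of \<open>T - J\<close>, so
      \<open>2 * (149/250 - m I) < 1 - m I - m J\<close>, that is
      \<open>m J < m I - 48/250 < 53/250\<close>.\<close>
    have "\<exists>k\<in>T. adj j k \<and> adj j' k"
    proof (rule ccontr)
      assume no: "\<not> ?thesis"
      have "m (nb j \<inter> T) + m (nb j' \<inter> T) = m ((nb j \<inter> T) \<union> (nb j' \<inter> T))"
        using no TV by (intro m_Un[symmetric]) auto
      also have "\<dots> \<le> m (T - J)"
        using j J(3) TV unfolding indep_def by (intro m_mono) auto
      also have "\<dots> = m T - m J"
        using m_Int_Diff[OF TV, of J] J(2) by (simp add: Int_absorb1)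
      finally have "m (nb j \<inter> T) + m (nb j' \<inter> T) \<le> 1 - m I - m J"
        by (simp add: mT)
      moreover have "m (nb j \<inter> I) \<le> m I" "m (nb j' \<inter> I) \<le> m I"
        using I by (auto intro!: m_mono)
      ultimately show False
        using degT[OF V(3)] degT[OF V(4)] mJ mI' by linarith
    qed
    then obtain k where k: "k \<in> T" "adj j k" "adj j' k" by blast
    have kV: "k \<in> V" using k(1) TV by blast
    have pent: "pentagon j c c' j' k"
      using c j k unfolding pentagon_def by (simp add: adj_commute)
    \<comment> \<open>Vertices of \<open>T\<close> see at most two of the five, those of
      \<open>I\<close> at most four as there is no wheel. The degree sum is at most
      \<open>2 + 2 * m I < 702/250\<close>, but it should exceed
      \<open>5 * 149/250 = 745/250\<close>.\<close>
    have "m (nb j \<inter> T) + m (nb c \<inter> T) + m (nb c' \<inter> T) + m (nb j' \<inter> T) + m (nb k \<inter> T) \<le> 2 * m T"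
      using c j k J(2) by (intro pentagon_degree_sum[OF pent _ TV tf]) auto
    moreover have "m (nb j \<inter> I) + m (nb c \<inter> I) + m (nb c' \<inter> I) + m (nb j' \<inter> I) + m (nb k \<inter> I) \<le> 4 * m I"
    proof (rule m_sum5_le[OF I(2)])
      fix p
      have "\<not> (adj j p \<and> adj c p \<and> adj c' p \<and> adj j' p \<and> adj k p)"
        using no_wheel[OF pent, of p] by (simp add: adj_commute)
      then show "of_bool (adj j p) + of_bool (adj c p) + of_bool (adj c' p) + of_bool (adj j' p)
          + of_bool (adj k p) \<le> (4::real)"
        by (cases "adj j p"; cases "adj c p"; cases "adj c' p"; cases "adj j' p"; cases "adj k p")
          simp_all
    qed
    ultimately show False
      using degT[OF V(1)] degT[OF V(2)] degT[OF V(3)] degT[OF V(4)] degT[OF kV] mT mI' by linarith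
  qed
  then show thesis
    using that[OF I(2) JV _ I(3) J(3)] J(2) by (auto simp: T_def)
qed

end

end

section \<open>Pentagons inside a neighbourhood\<close>

text \<open>In the next three lemmas \<open>d\<close> is the relative size of \<open>D = N(a)\<close> and \<open>b = 1 - d\<close>; for \<open>v\<close> in \<open>D\<close>,
  \<open>k\<^sub>v\<close> is the relative degree of \<open>v\<close> into \<open>D\<close> and \<open>\<mu>\<^sub>v\<close> the relative number of its non-neighbours
  outside \<open>D\<close>.\<close>

lemma wheel_rim_bound:
  fixes b k1 k2 k3 k4 k5 \<mu>1 \<mu>2 \<mu>3 \<mu>4 \<mu>5 :: real
  assumes b: "b \<le> 397 / 1000"
    and \<mu>: "0 \<le> \<mu>1" "0 \<le> \<mu>2" "0 \<le> \<mu>3" "0 \<le> \<mu>4" "0 \<le> \<mu>5"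
    and k: "149 / 250 < k1 + (b - \<mu>1)" "149 / 250 < k2 + (b - \<mu>2)" "149 / 250 < k3 + (b - \<mu>3)"
      "149 / 250 < k4 + (b - \<mu>4)" "149 / 250 < k5 + (b - \<mu>5)"
    and l: "4 / 45 < k1 * (b - \<mu>1) + \<mu>2 * max 0 (b - k1)" "4 / 45 < k2 * (b - \<mu>2) + \<mu>3 * max 0 (b - k2)"
      "4 / 45 < k3 * (b - \<mu>3) + \<mu>4 * max 0 (b - k3)" "4 / 45 < k4 * (b - \<mu>4) + \<mu>5 * max 0 (b - k4)"
      "4 / 45 < k5 * (b - \<mu>5) + \<mu>1 * max 0 (b - k5)"
  shows "4 / 9 < b * (k1 + k2 + k3 + k4 + k5)"
proof -
  \<comment> \<open>Both \<open>k\<close> and \<open>k'\<close> exceed \<open>149/250 - b\<close>,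
    so \<open>b - k \<le> k'\<close> once \<open>3 * b \<le> 298/250\<close>; 397/1000 lies just
    below this limit. The gain from \<open>k'\<close> is that the terms \<open>\<mu> * k\<close> and
    \<open>\<mu>' * k'\<close> cancel around the pentagon.\<close>
  have step: "4 / 45 < b * k - \<mu> * k + \<mu>' * k'"
    if "4 / 45 < k * (b - \<mu>) + \<mu>' * max 0 (b - k)" "0 \<le> \<mu>" "0 \<le> \<mu>'"
      "149 / 250 < k + (b - \<mu>)" "149 / 250 < k' + (b - \<mu>')" for k k' \<mu> \<mu>'
  proof -
    have "\<mu>' * max 0 (b - k) \<le> \<mu>' * k'"
      by (rule mult_left_mono) (use that(2-5) b in auto)
    from less_le_trans[OF that(1) add_left_mono[OF this]] show ?thesis
      by (simp add: algebra_simps)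
  qed
  show ?thesis
    using step[OF l(1) \<mu>(1,2) k(1,2)] step[OF l(2) \<mu>(2,3) k(2,3)] step[OF l(3) \<mu>(3,4) k(3,4)]
      step[OF l(4) \<mu>(4,5) k(4,5)] step[OF l(5) \<mu>(5,1) k(5,1)]
    by (simp add: distrib_left)
qed

text \<open>Here \<open>u\<close>, \<open>z\<close>, \<open>w\<close> are consecutive on a pentagon
  whose other two vertices have large degree sum into \<open>D\<close>, which makes
  \<open>ku + kz + kw\<close> small. The links of \<open>u\<close> and \<open>w\<close> are
  estimated through their neighbour \<open>z\<close>, that of \<open>z\<close> through
  \<open>u\<close>; the gains at \<open>\<mu>z\<close> and \<open>\<mu>u\<close> are then paid for
  by the losses \<open>\<mu>z * kz\<close> and \<open>\<mu>u * ku\<close>, up to the error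
  \<open>h\<close>.\<close>

lemma wheel_spoke_bound:
  fixes b d ku kz kw \<mu>u \<mu>z \<mu>w :: real
  assumes d: "149 / 250 < d" "d < 2 / 3" and b: "b = 1 - d"
    and \<mu>: "0 \<le> \<mu>u" "0 \<le> \<mu>z" "0 \<le> \<mu>w"
    and k: "149 / 250 < ku + (b - \<mu>u)" "149 / 250 < kz + (b - \<mu>z)" "149 / 250 < kw + (b - \<mu>w)"
    and l: "4 / 45 < ku * (b - \<mu>u) + \<mu>z * max 0 (b - ku)" "4 / 45 < kw * (b - \<mu>w) + \<mu>z * max 0 (b - kw)"
      "4 / 45 < kz * (b - \<mu>z) + \<mu>u * max 0 (b - kz)"
    and s: "(ku + kz + kw) * d < 2 * d^2 - 16 / 45"
  shows False
proof -
  define s where "s = ku + kz + kw"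
  \<comment> \<open>The excess of \<open>max 0 (b - ku) + max 0 (b - kw)\<close> over
    \<open>kz\<close> is largest when all three degrees are at their lower bound
    \<open>149/250 - b\<close>; there it equals \<open>2 * b - 3 * (149/250 - b)\<close>. The same
    \<open>h\<close> covers the smaller excess of \<open>b - kz\<close> over
    \<open>ku\<close>.\<close>
  define h where "h = max 0 (5 * b - 447 / 250)"
  define M where "M = \<mu>u + \<mu>z + \<mu>w"
  have bb: "1 / 3 < b" "b < 101 / 250" using d b by auto
  have h0: "0 \<le> h" by (simp add: h_def)
  have p1: "\<mu>u * max 0 (b - kz) \<le> \<mu>u * (ku + h)"
    using bb \<mu> k by (intro mult_left_mono) (auto simp: h_def)
  have "max 0 (b - ku) + max 0 (b - kw) \<le> kz + h"
    using bb \<mu> k by (auto simp: h_def max_def)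
  then have p2: "\<mu>z * (max 0 (b - ku) + max 0 (b - kw)) \<le> \<mu>z * (kz + h)"
    using \<mu> by (intro mult_left_mono)
  have p3: "0 \<le> \<mu>w * kw" "0 \<le> \<mu>w * h"
    using bb \<mu> k h0 by (auto intro!: mult_nonneg_nonneg)
  have main: "4 / 15 < b * s + M * h"
  proof -
    have gen: "4 / 15 < b * (ku + kz + kw) + (\<mu>u + \<mu>z + \<mu>w) * h"
      if "4 / 45 < ku * (b - \<mu>u) + \<mu>z * X" "4 / 45 < kw * (b - \<mu>w) + \<mu>z * Y"
        "4 / 45 < kz * (b - \<mu>z) + W" "W \<le> \<mu>u * (ku + h)" "\<mu>z * (X + Y) \<le> \<mu>z * (kz + h)"
        "0 \<le> \<mu>w * kw" "0 \<le> \<mu>w * h" for W X Y h :: real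
      using that by (simp add: algebra_simps)
    show ?thesis
      unfolding s_def M_def by (rule gen[OF l p1 p2 p3])
  qed
  have sd: "s * d < 2 * d^2 - 16 / 45" using s by (simp add: s_def)
  show False
  proof (cases "5 * b \<le> 447 / 250")
    case True
    then have "4 / 15 < b * s" using main by (simp add: h_def)
    then have "4 / 15 * d < b * s * d" using d by simp
    also have "b * s * d = b * (s * d)" by simp
    also have "\<dots> < b * (2 * d^2 - 16 / 45)"
      using sd bb by (intro mult_strict_left_mono) auto
    \<comment> \<open>The root \<open>d = 2/3\<close> is the hub degree in the extremal wheel
      blow-up, where the estimate is an equality.\<close>
    finally have "0 < (d - 2 / 3) * (8 / 15 + d * (2 / 3 - 2 * d))"
      unfolding b by (simp add: algebra_simps power2_eq_square add_divide_distrib diff_divide_distrib)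
    moreover have "0 < 8 / 15 + d * (2 / 3 - 2 * d)"
    proof -
      have "d * (2 * d - 2 / 3) \<le> (2 / 3) * (2 / 3)"
        using d by (intro mult_mono) auto
      then show ?thesis by (simp add: algebra_simps)
    qed
    ultimately show False
      using d by (simp add: zero_less_mult_iff)
  next
    case False
    then have h: "h = 5 * b - 447 / 250" by (simp add: h_def)
    have "M \<le> s - 447 / 250 + 3 * b" using k by (simp add: M_def s_def)
    then have "M * h \<le> (s - 447 / 250 + 3 * b) * h" using h0 by (rule mult_right_mono)
    then have "4 / 15 < b * s + (s - 447 / 250 + 3 * b) * h" using main by simp
    then have "4 / 15 * d < (b * s + (s - 447 / 250 + 3 * b) * h) * d" using d by simp
    also have "\<dots> = (6 * b - 447 / 250) * (s * d) + (3 * b - 447 / 250) * h * d"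
      by (simp add: h algebra_simps)
    also have "\<dots> \<le> (6 * b - 447 / 250) * (2 * d^2 - 16 / 45) + (3 * b - 447 / 250) * h * d"
      using sd bb False by (intro add_right_mono mult_left_mono) auto
    finally have *: "4 / 15 * d < (6 * b - 447 / 250) * (2 * d^2 - 16 / 45) + (3 * b - 447 / 250) * h * d" .
    have d': "d = 1 - b" using b by simp
    \<comment> \<open>With \<open>h\<close> and \<open>d\<close> substituted, \<open>*\<close> is a
      cubic inequality in \<open>b\<close>; \<open>2155 / 10000\<close> and
      \<open>99 / 10000\<close> below are two of its coefficients rounded down. To the right of
      447/1250 the function \<open>b * (1728 / 1000 - 3 * b)\<close> decreases, so its value at this
      end bounds it.\<close>
    have "0 \<le> (b - 447 / 1250) * (3 * (b + 447 / 1250) - 1728 / 1000)"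
      using False by (intro mult_nonneg_nonneg) auto
    then have q: "b * (1728 / 1000 - 3 * b) \<le> 235 / 1000"
      by (simp add: algebra_simps)
    then have "b * (b * (1728 / 1000 - 3 * b) - 2155 / 10000) \<le> b * (235 / 1000 - 2155 / 10000)"
      using bb by (intro mult_left_mono) auto
    also have "\<dots> \<le> 101 / 250 * (235 / 1000 - 2155 / 10000)"
      using bb by (intro mult_right_mono) auto
    finally have "b * (b * (1728 / 1000 - 3 * b) - 2155 / 10000) < 99 / 10000" by simp
    then show False
      using * bb unfolding h d'
      by (simp add: algebra_simps power2_eq_square add_divide_distrib diff_divide_distrib)
  qed
qed

text \<open>For an edge \<open>z z'\<close> of \<open>D\<close> seeing nothing of
  \<open>N(x)\<close> in \<open>D\<close>, the three degrees \<open>kx\<close>, \<open>kz\<close>,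
  \<open>kz'\<close> measure disjoint parts of \<open>D\<close>. Each exceeds
  \<open>d - 101/250\<close>, so \<open>d\<close> and \<open>kx\<close> are bounded above. The edges
  in \<open>D\<close> then run between the neighbourhoods of \<open>x\<close> and \<open>y\<close>,
  or meet a remainder of size \<open>d - kx - ky\<close> with degrees below 101/250, and are too
  few.\<close>

lemma far_edge_bound:
  fixes d kx ky kz kz' :: real
  assumes "149 / 250 < d" "d - 101 / 250 < kx" "d - 101 / 250 < kz" "d - 101 / 250 < kz'"
    and sum: "kx + kz + kz' \<le> d"
    and xy: "16 / 45 < (kx + ky) * d" "kx + ky \<le> d"
    and e: "4 / 45 < kx * ky + (d - kx - ky) * (101 / 250)"
  shows False
proof -
  define c where "c = 202 / 250 - d"
  define t where "t = d - kx - ky"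
  have d: "d < 606 / 1000" using assms by simp
  have kx: "kx < c" "192 / 1000 < kx" using assms by (auto simp: c_def)
  \<comment> \<open>Since \<open>kx < c\<close> and \<open>c\<close> is below \<open>d / 2\<close>,
    the product \<open>kx * (d - kx)\<close> is at most its value at \<open>c\<close>, a quadratic
    in \<open>d\<close> with maximum at 606/1000.\<close>
  have "0 \<le> (c - kx) * (d - c - kx)"
    using kx d assms(1) by (intro mult_nonneg_nonneg) (auto simp: c_def)
  then have "kx * (d - kx) \<le> c * (d - c)" by (simp add: algebra_simps)
  also have "\<dots> = 81608 / 1000000 - 2 * (d - 606 / 1000)^2"
    by (simp add: c_def power2_eq_square algebra_simps)
  also have "\<dots> \<le> 81608 / 1000000" by simp
  finally have 1: "kx * (d - kx) \<le> 81608 / 1000000" .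
  have t0: "0 \<le> t" using xy by (simp add: t_def)
  have "t * (149 / 250) \<le> t * d" using t0 assms(1) by (intro mult_left_mono) auto
  also have "\<dots> = d * d - (kx + ky) * d" by (simp add: t_def algebra_simps)
  also have "\<dots> < (606 / 1000) * (606 / 1000) - 16 / 45"
    using xy(1) mult_strict_mono[OF d d] assms(1) by simp
  finally have t1: "t < 20 / 1000" by simp
  have "t * (101 / 250 - kx) \<le> 20 / 1000 * (212 / 1000)"
    using t0 t1 kx d assms(1) by (intro mult_mono) (auto simp: c_def)
  moreover have "kx * ky + (d - kx - ky) * (101 / 250) = kx * (d - kx) + t * (101 / 250 - kx)"
    by (simp add: t_def algebra_simps)
  ultimately show False using e 1 by simp
qed

section \<open>Links of the vertices of a wheel\<close>

context dense_k4_free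
begin

text \<open>This is the quantity \<open>\<mu>\<^sub>v\<close> for \<open>D = nb a\<close>.\<close>

definition missing :: "'a \<Rightarrow> 'a \<Rightarrow> real" where
  "missing a v = 1 - m (nb a) - m (nb v - nb a)"

lemma missing_nonneg:
  assumes "a \<in> V"
  shows "0 \<le> missing a v"
proof -
  have "m (nb v - nb a) \<le> m (V - nb a)"
    using nb_subset by (intro m_mono) blast+
  then show ?thesis
    using m_compl[OF assms nb_subset] by (simp add: missing_def)
qed

lemma codegree_missing:
  assumes "v \<in> V"
  shows "149 / 250 < m (nb v \<inter> nb a) + (1 - m (nb a) - missing a v)"
  using min_degree[OF assms] m_Int_Diff[OF nb_subset, of v "nb a"] by (simp add: missing_def)

lemma nb_triangle_free:
  "x \<in> nb a \<Longrightarrow> y \<in> nb a \<Longrightarrow> z \<in> nb a \<Longrightarrow> adj x y \<Longrightarrow> adj y z \<Longrightarrow> \<not> adj x z"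
  using k4_free[of a x y z] by auto

text \<open>The triangle-free bound is applied to \<open>nb z\<close>, split into
  \<open>nb z \<inter> nb a\<close> and \<open>B = nb z - nb a\<close>. The first set and the part
  of \<open>B\<close> inside \<open>nb u\<close> are independent, as they lie in common
  neighbourhoods of edges; so \<open>Q = B - nb u\<close>, of density at most
  \<open>missing a u\<close>, meets every edge of \<open>B\<close>.\<close>

lemma link_bound:
  assumes "adj a z" "adj a u" "adj z u"
  shows "4 / 45 < m (nb z \<inter> nb a) * (1 - m (nb a) - missing a z)
           + missing a u * max 0 (1 - m (nb a) - m (nb z \<inter> nb a))"
proof -
  let ?K = "nb z \<inter> nb a" and ?B = "nb z - nb a"
  let ?Q = "?B - nb u" and ?n = "real (card V)"
  have V: "a \<in> V" "z \<in> V"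
    using assms adj_V by blast+
  note n = card_V_pos[OF V(1)]
  have KB: "?K \<union> ?B = nb z" by auto
  have "card (arcs adj (?K \<union> ?B)) \<le> 2 * (card ?K * card ?B + card ?Q * (card ?B - card ?K))"
  proof (rule triangle_free_arcs_bound)
    show "finite ?K" "finite ?B" using finite_nb by auto
    show "adj y x" if "adj x y" for x y using that by (rule adj_sym)
    show "?K \<inter> ?B = {}" "?Q \<subseteq> ?B" by auto
    show "indep adj ?K" using common_nb_indep[OF adj_sym[OF assms(1)]] .
    have "?B - ?Q \<subseteq> nb z \<inter> nb u" by auto
    then show "indep adj (?B - ?Q)" by (rule indep_subset[OF common_nb_indep[OF assms(3)]])
    show "\<not> adj x w" if "x \<in> ?K \<union> ?B" "y \<in> ?K \<union> ?B" "w \<in> ?K \<union> ?B" "adj x y" "adj y w" for x y w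
      by (rule nb_triangle_free[OF that[unfolded KB]])
  qed
  then have "real (card (arcs adj (nb z))) \<le> real (2 * (card ?K * card ?B + card ?Q * (card ?B - card ?K)))"
    unfolding KB of_nat_le_iff .
  also have "\<dots> = 2 * (real (card ?K) * real (card ?B) + real (card ?Q) * max 0 (real (card ?B) - real (card ?K)))"
    by (simp add: of_nat_diff max_def)
  finally have "8 / 45 * ?n^2 < 2 * (real (card ?K) * real (card ?B) + real (card ?Q) * max 0 (real (card ?B) - real (card ?K)))"
    using dense[OF V(2)] by (simp add: nb_def)
  moreover have c: "real (card ?K) = m ?K * ?n" "real (card ?B) = m ?B * ?n" "real (card ?Q) = m ?Q * ?n"
    using n by (simp_all add: m_def)
  moreover have "max 0 (m ?B * ?n - m ?K * ?n) = max 0 (m ?B - m ?K) * ?n"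
    using n by (auto simp: max_def algebra_simps)
  moreover have "2 * (p * N * (q * N) + r * N * (h * N)) = 2 * (p * q + r * h) * N^2" for p q r h N :: real
    by (simp add: power2_eq_square algebra_simps)
  ultimately have "8 / 45 * ?n^2 < 2 * (m ?K * m ?B + m ?Q * max 0 (m ?B - m ?K)) * ?n^2"
    by (simp only:)
  then have *: "4 / 45 < m ?K * m ?B + m ?Q * max 0 (m ?B - m ?K)"
    using n by simp
  have "m ?Q \<le> m ((V - nb a) - (nb u - nb a))"
    using nb_subset by (intro m_mono) blast+
  also have "\<dots> = m (V - nb a) - m (nb u - nb a)"
  proof -
    have "(V - nb a) \<inter> (nb u - nb a) = nb u - nb a"
      using nb_subset by blast
    then show ?thesis
      using m_Int_Diff[of "V - nb a" "nb u - nb a"] by simp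
  qed
  finally have Q: "m ?Q \<le> missing a u"
    using m_compl[OF V(1) nb_subset] by (simp add: missing_def)
  have B: "m ?B = 1 - m (nb a) - missing a z"
    by (simp add: missing_def)
  have "m ?Q * max 0 (m ?B - m ?K) \<le> missing a u * max 0 (1 - m (nb a) - m ?K)"
    using Q missing_nonneg[OF V(1), of u] missing_nonneg[OF V(1), of z] B by (intro mult_mono) auto
  then show ?thesis
    using * B by simp
qed

text \<open>Its use is that every edge inside \<open>nb a\<close> has an end with a neighbour in
  \<open>nb x \<inter> nb a\<close>, which is what allows \<open>nb a\<close> to be two-coloured
  starting from the edge \<open>x y\<close>.\<close>

lemma no_far_edge:
  assumes xy: "adj a x" "adj a y" "adj x y"
    and sum: "16 / 45 < (m (nb x \<inter> nb a) + m (nb y \<inter> nb a)) * m (nb a)"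
    and z: "adj a z" "adj a z'" "adj z z'"
    and far: "nb z \<inter> nb a \<inter> nb x = {}" "nb z' \<inter> nb a \<inter> nb x = {}"
  shows False
proof (rule far_edge_bound[of "m (nb a)" "m (nb x \<inter> nb a)" "m (nb z \<inter> nb a)" "m (nb z' \<inter> nb a)" "m (nb y \<inter> nb a)"])
  have V: "a \<in> V" "x \<in> V" "y \<in> V" "z \<in> V" "z' \<in> V"
    using xy z adj_V adj_sym by blast+
  show "149 / 250 < m (nb a)" by (rule min_degree[OF V(1)])
  have low: "m (nb a) - 101 / 250 < m (nb v \<inter> nb a)" if "v \<in> V" for v
    using m_Int_ge[OF V(1) nb_subset nb_subset, of v a] min_degree[OF that] by simp
  show "m (nb a) - 101 / 250 < m (nb x \<inter> nb a)" "m (nb a) - 101 / 250 < m (nb z \<inter> nb a)"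
    "m (nb a) - 101 / 250 < m (nb z' \<inter> nb a)"
    using low V by auto
  let ?D = "nb a" and ?X = "nb x \<inter> nb a" and ?Y = "nb y \<inter> nb a"
  have no: "\<not> (adj z p \<and> adj z' p)" "\<not> (adj x p \<and> adj y p)" if "adj a p" for p
    using nb_triangle_free[of z a z' p] nb_triangle_free[of x a y p] xy z that by auto
  have zz': "nb z \<inter> ?D \<inter> (nb z' \<inter> ?D) = {}" and XY0: "?X \<inter> ?Y = {}"
    using no by auto
  have sub: "?X \<subseteq> V" "?Y \<subseteq> V" "nb z \<inter> ?D \<subseteq> V" "nb z' \<inter> ?D \<subseteq> V" "?X \<union> (nb z \<inter> ?D) \<subseteq> V"
    using nb_subset[of a] by blast+
  have "m (?X \<union> (nb z \<inter> ?D) \<union> (nb z' \<inter> ?D)) = m (?X \<union> (nb z \<inter> ?D)) + m (nb z' \<inter> ?D)"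
    by (rule m_Un) (use sub far zz' in blast)+
  moreover have "m (?X \<union> (nb z \<inter> ?D)) = m ?X + m (nb z \<inter> ?D)"
    by (rule m_Un) (use sub far in blast)+
  moreover have "m (?X \<union> (nb z \<inter> ?D) \<union> (nb z' \<inter> ?D)) \<le> m ?D"
    using nb_subset by (intro m_mono) blast+
  ultimately show "m ?X + m (nb z \<inter> ?D) + m (nb z' \<inter> ?D) \<le> m ?D"
    by simp
  show "16 / 45 < (m ?X + m ?Y) * m ?D" by (rule sum)
  have XY: "m (?X \<union> ?Y) = m ?X + m ?Y"
    using sub XY0 by (intro m_Un)
  moreover have "m (?X \<union> ?Y) \<le> m ?D"
    using nb_subset by (intro m_mono) blast+
  ultimately show "m ?X + m ?Y \<le> m ?D" by simp
  let ?Z = "?D - (?X \<union> ?Y)" and ?n = "real (card V)"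
  note n = card_V_pos[OF V(1)]
  have Z: "m ?Z = m ?D - m ?X - m ?Y"
    using m_Int_Diff[OF nb_subset, of a "?X \<union> ?Y"] XY by (simp add: Int_absorb1 Int_Un_distrib Int_commute)
  let ?S = "SIGMA z:?Z. {p \<in> ?D. adj z p}"
  have "?S \<subseteq> ?D \<times> ?D" by blast
  then have fin: "finite ?D" "finite ?Z" "finite ?X" "finite ?Y" "finite ?S"
    using finite_nb[of a] by (auto dest: finite_subset)
  have iX: "\<not> adj p q" if "p \<in> ?X" "q \<in> ?X" for p q
    using common_nb_indep[OF adj_sym[OF xy(1)]] that unfolding indep_def by blast
  have iY: "\<not> adj p q" if "p \<in> ?Y" "q \<in> ?Y" for p q
    using common_nb_indep[OF adj_sym[OF xy(2)]] that unfolding indep_def by blast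
  have "arcs adj ?D \<subseteq> (?X \<times> ?Y \<union> ?Y \<times> ?X) \<union> (?S \<union> prod.swap ` ?S)"
  proof
    fix e assume "e \<in> arcs adj ?D"
    then obtain p q where e: "e = (p, q)" "p \<in> ?D" "q \<in> ?D" "adj p q"
      by (auto simp: arcs_def)
    have "(q, p) \<in> ?S" if "q \<in> ?Z" using that e(2,3) adj_sym[OF e(4)] by auto
    then have "e \<in> prod.swap ` ?S" if "q \<in> ?Z"
      unfolding e(1) using that by (intro rev_image_eqI[of "(q, p)"]) auto
    moreover have "e \<in> ?S" if "p \<in> ?Z" using that e by auto
    moreover have "e \<in> ?X \<times> ?Y \<union> ?Y \<times> ?X" if "p \<notin> ?Z" "q \<notin> ?Z"
      using that e iX[of p q] iY[of p q] by auto
    ultimately show "e \<in> (?X \<times> ?Y \<union> ?Y \<times> ?X) \<union> (?S \<union> prod.swap ` ?S)" by blast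
  qed
  then have "card (arcs adj ?D) \<le> card ((?X \<times> ?Y \<union> ?Y \<times> ?X) \<union> (?S \<union> prod.swap ` ?S))"
    using fin by (intro card_mono) auto
  also have "\<dots> \<le> (card (?X \<times> ?Y) + card (?Y \<times> ?X)) + (card ?S + card (prod.swap ` ?S))"
    by (meson add_mono card_Un_le le_trans)
  also have "card (prod.swap ` ?S) = card ?S"
    by (intro card_image) (auto simp: inj_on_def)
  finally have "card (arcs adj ?D) \<le> 2 * (card ?X * card ?Y + card ?S)"
    by (simp add: card_cartesian_product algebra_simps)
  then have "real (card (arcs adj ?D)) \<le> 2 * (real (card ?X) * real (card ?Y) + real (card ?S))"
    unfolding of_nat_le_iff[where 'a = real, symmetric] of_nat_mult of_nat_add of_nat_numeral .
  moreover have "real (card ?S) \<le> real (card ?Z) * (101 / 250 * ?n)"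
  proof -
    have "\<forall>z\<in>?Z. finite {p \<in> ?D. adj z p}"
      by (intro ballI finite_subset[OF _ fin(1)] Collect_restrict)
    then have "card ?S = (\<Sum>z\<in>?Z. card {p \<in> ?D. adj z p})"
      using fin(2) by (intro card_SigmaI)
    then have "real (card ?S) = (\<Sum>z\<in>?Z. real (card {p \<in> ?D. adj z p}))"
      by simp
    also have "\<dots> \<le> (\<Sum>z\<in>?Z. 101 / 250 * ?n)"
    proof (rule sum_mono)
      fix z assume "z \<in> ?Z"
      then have "indep adj (nb z \<inter> nb a)"
        by (intro common_nb_indep adj_sym[of a z]) simp
      then have "m (nb z \<inter> nb a) < 101 / 250"
        using nb_subset by (intro indep_small) blast+
      moreover have "{p \<in> ?D. adj z p} = nb z \<inter> nb a" by auto
      ultimately show "real (card {p \<in> ?D. adj z p}) \<le> 101 / 250 * ?n"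
        using n by (simp add: m_def field_simps)
    qed
    finally show ?thesis by simp
  qed
  ultimately have "8 / 45 * ?n^2 < 2 * (real (card ?X) * real (card ?Y) + real (card ?Z) * (101 / 250 * ?n))"
  proof -
    have gen: "r < 2 * (p + t)" if "q \<le> 2 * (p + s)" "s \<le> t" "r < q" for p q r s t :: real
      using that by (smt (verit))
    assume "real (card (arcs adj ?D)) \<le> 2 * (real (card ?X) * real (card ?Y) + real (card ?S))"
      "real (card ?S) \<le> real (card ?Z) * (101 / 250 * ?n)"
    then show ?thesis
      by (rule gen[OF _ _ dense[OF V(1), folded nb_def]])
  qed
  moreover have c: "real (card ?X) = m ?X * ?n" "real (card ?Y) = m ?Y * ?n" "real (card ?Z) = m ?Z * ?n"
    using n by (simp_all add: m_def)
  moreover have "2 * (p * N * (q * N) + r * N * (h * N)) = 2 * (p * q + r * h) * N^2" for p q r h N :: real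
    by (simp add: power2_eq_square algebra_simps)
  ultimately have "8 / 45 * ?n^2 < 2 * (m ?X * m ?Y + m ?Z * (101 / 250)) * ?n^2"
    by (simp only:)
  then have "4 / 45 < m ?X * m ?Y + m ?Z * (101 / 250)"
    using n by simp
  then show "4 / 45 < m ?X * m ?Y + (m ?D - m ?X - m ?Y) * (101 / 250)"
    by (simp add: Z)
qed

text \<open>Each rim vertex has its link estimated through the next one. With the degree sum at most
  \<open>2 * d\<close>, where \<open>d = m (nb a)\<close>, this gives
  \<open>4/9 < 2 * d * (1 - d)\<close>, which fails from \<open>d = 2/3\<close> on.\<close>

lemma wheel_hub_degree:
  assumes pent: "pentagon c1 c2 c3 c4 c5" and C: "{c1, c2, c3, c4, c5} \<subseteq> nb a"
  shows "m (nb a) < 2 / 3"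
proof (rule ccontr)
  assume "\<not> m (nb a) < 2 / 3"
  then have d: "2 / 3 \<le> m (nb a)" by simp
  have ac: "adj a c1" "adj a c2" "adj a c3" "adj a c4" "adj a c5"
    using C by auto
  have cc: "adj c1 c2" "adj c2 c3" "adj c3 c4" "adj c4 c5" "adj c5 c1"
    using pent by (auto simp: pentagon_def)
  have V: "a \<in> V" "c1 \<in> V" "c2 \<in> V" "c3 \<in> V" "c4 \<in> V" "c5 \<in> V"
    using ac cc adj_V by blast+
  let ?k = "\<lambda>v. m (nb v \<inter> nb a)" and ?b = "1 - m (nb a)"
  have "4 / 9 < ?b * (?k c1 + ?k c2 + ?k c3 + ?k c4 + ?k c5)"
    by (rule wheel_rim_bound[of ?b "missing a c1" "missing a c2" "missing a c3" "missing a c4" "missing a c5"])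
      (use d in simp, (rule missing_nonneg[OF V(1)])+, (rule codegree_missing, rule V)+,
        (rule link_bound, rule ac, rule ac, rule cc)+)
  also have "\<dots> \<le> ?b * (2 * m (nb a))"
  proof (rule mult_left_mono)
    show "?k c1 + ?k c2 + ?k c3 + ?k c4 + ?k c5 \<le> 2 * m (nb a)"
      by (rule pentagon_degree_sum[OF pent C nb_subset nb_triangle_free])
    show "0 \<le> ?b"
      using m_mono[OF nb_subset order_refl, of a] m_V[OF V(1)] by simp
  qed
  finally have "0 < (m (nb a) - 1 / 3) * (2 / 3 - m (nb a))"
    by (simp add: algebra_simps)
  then show False
    using d by (simp add: zero_less_mult_iff)
qed

text \<open>For an edge \<open>x y\<close> of \<open>nb a\<close> with large degree sum, a pentagon
  through it inside \<open>nb a\<close> contradicts \<open>wheel_spoke_bound\<close>. Without such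
  pentagons \<open>col\<close> is a proper two-colouring of \<open>nb a\<close>, and the given
  pentagon is an odd closed walk.\<close>

lemma no_wheel:
  assumes pent: "pentagon c1 c2 c3 c4 c5"
  shows "\<not> {c1, c2, c3, c4, c5} \<subseteq> nb a"
proof
  assume C: "{c1, c2, c3, c4, c5} \<subseteq> nb a"
  let ?k = "\<lambda>v. m (nb v \<inter> nb a)" and ?d = "m (nb a)" and ?n = "real (card V)"
  have "adj a c1" using C by simp
  then have aV: "a \<in> V" by (rule adj_V)
  note n = card_V_pos[OF aV] and d1 = min_degree[OF aV] and d2 = wheel_hub_degree[OF pent C]
  have "arcs adj (nb a) \<noteq> {}"
    using pent C by (auto simp: arcs_def pentagon_def)
  from ex_arc_large_degree_sum[of "nb a" adj, OF finite_nb adj_sym this]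
  obtain x y where xy': "x \<in> nb a" "y \<in> nb a" "adj x y"
    and large: "2 * card (arcs adj (nb a)) \<le> (card {z\<in>nb a. adj x z} + card {z\<in>nb a. adj y z}) * card (nb a)" .
  then have xy: "adj a x" "adj a y" "adj x y"
    by auto
  have sum: "16 / 45 < (?k x + ?k y) * ?d"
  proof -
    have eq: "{z\<in>nb a. adj v z} = nb v \<inter> nb a" for v by auto
    have "2 * real (card (arcs adj (nb a))) \<le> (real (card (nb x \<inter> nb a)) + real (card (nb y \<inter> nb a))) * real (card (nb a))"
      using large
      unfolding eq of_nat_le_iff[where 'a = real, symmetric] of_nat_mult of_nat_add of_nat_numeral .
    moreover have c: "real (card S) = m S * ?n" for S
      using n by (simp add: m_def)
    ultimately have "16 / 45 * ?n^2 < (m (nb x \<inter> nb a) * ?n + m (nb y \<inter> nb a) * ?n) * (m (nb a) * ?n)"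
      using dense[OF aV] unfolding nb_def[symmetric] c[symmetric] by linarith
    then have "16 / 45 * ?n^2 < ((?k x + ?k y) * ?d) * ?n^2"
      by (simp add: power2_eq_square algebra_simps)
    then show ?thesis using n by simp
  qed
  have no_pent: False
    if zuw: "adj a z" "adj a u" "adj a w" "adj x u" "adj u z" "adj z w" "adj w y" for z u w
  proof -
    have V: "z \<in> V" "u \<in> V" "w \<in> V"
      using zuw adj_V adj_sym by blast+
    have s: "adj z u" "adj w z" using adj_sym zuw by blast+
    have "pentagon x u z w y"
      using zuw adj_sym[OF xy(3)] by (simp add: pentagon_def)
    moreover have "{x, u, z, w, y} \<subseteq> nb a"
      using zuw xy by simp
    ultimately have "?k x + ?k u + ?k z + ?k w + ?k y \<le> 2 * ?d"
      by (rule pentagon_degree_sum[OF _ _ nb_subset nb_triangle_free[of _ a]])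
    then have "(?k u + ?k z + ?k w) * ?d \<le> (2 * ?d - (?k x + ?k y)) * ?d"
      by (intro mult_right_mono) auto
    then have "(?k u + ?k z + ?k w) * ?d < 2 * ?d^2 - 16 / 45"
      using sum by (simp add: algebra_simps power2_eq_square)
    then show False
      using wheel_spoke_bound[OF d1 d2 refl missing_nonneg[OF aV, of u] missing_nonneg[OF aV, of z]
          missing_nonneg[OF aV, of w] codegree_missing[OF V(2)] codegree_missing[OF V(1)]
          codegree_missing[OF V(3)] link_bound[OF zuw(2,1,5)] link_bound[OF zuw(3,1) s(2)]
          link_bound[OF zuw(1,2) s(1)]] by blast
  qed
  have sum': "16 / 45 < (?k y + ?k x) * ?d" using sum by (simp add: add.commute)
  note far = no_far_edge[OF xy sum] and far' = no_far_edge[OF xy(2,1) adj_sym[OF xy(3)] sum']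
  \<comment> \<open>The true class collects the neighbours of \<open>x\<close> and the vertices
    outside \<open>nb y\<close> that have a neighbour in \<open>nb y \<inter> nb a\<close>.
    Neighbours of \<open>y\<close> get the other colour by triangle-freeness, vertices with no such
    link to \<open>x\<close> or \<open>y\<close> get it by default.\<close>
  define col where "col p \<longleftrightarrow> adj x p \<or> (\<not> adj y p \<and> (\<exists>w. adj a w \<and> adj y w \<and> adj p w))" for p
  have proper: "col p \<noteq> col q" if pq: "adj a p" "adj a q" "adj p q" for p q
  proof
    assume eq: "col p = col q"
    have qp: "adj q p" using adj_sym pq by blast
    have sx: "adj v x" if "adj x v" for v using adj_sym that by blast
    have sy: "adj v y" if "adj y v" for v using adj_sym that by blast
    have nX: "\<not> (adj x p \<and> adj x q)" and nY: "\<not> (adj y p \<and> adj y q)"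
      using nb_triangle_free[of x a p q] nb_triangle_free[of y a p q] xy pq by auto
    have zX: False if "adj a z" "adj a u" "adj a w" "adj x u" "adj z u" "adj z w" "adj y w" for z u w
      using no_pent[of z u w] that adj_sym[of z u] sy by blast
    show False
    proof (cases "col p")
      case True
      then have cq: "col q" using eq by simp
      consider "adj x p" | "adj x q" | "\<not> adj x p" "\<not> adj x q" by blast
      then show False
      proof cases
        case 1
        then obtain w where "adj a w" "adj y w" "adj q w" using cq nX unfolding col_def by blast
        then show False using zX[of q p w] pq 1 qp by blast
      next
        case 2
        then obtain w where "adj a w" "adj y w" "adj p w" using True nX unfolding col_def by blast
        then show False using zX[of p q w] pq 2 by blast
      next
        case 3
        obtain w w' where "adj a w" "adj y w" "adj p w" "adj a w'" "adj y w'" "adj q w'"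
          using True cq 3 unfolding col_def by blast
        then have "nb p \<inter> nb a \<inter> nb x = {}" "nb q \<inter> nb a \<inter> nb x = {}"
          using zX[of p _ w] zX[of q _ w'] pq by auto
        then show False using far pq by blast
      qed
    next
      case False
      then have cq: "\<not> col q" using eq by simp
      \<comment> \<open>If \<open>p\<close> were adjacent to \<open>y\<close>, then \<open>q\<close>
        would not be, and \<open>p\<close> would be the witness for \<open>col q\<close>.\<close>
      have "\<not> adj y p" using False cq nY qp pq unfolding col_def by blast
      moreover have "\<not> adj y q" using False cq nY pq unfolding col_def by blast
      ultimately have "nb p \<inter> nb a \<inter> nb y = {}" "nb q \<inter> nb a \<inter> nb y = {}"
        using False cq unfolding col_def by auto
      then show False using far' pq by blast
    qed
  qed
  have ac: "adj a c1" "adj a c2" "adj a c3" "adj a c4" "adj a c5"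
    using C by auto
  have cc: "adj c1 c2" "adj c2 c3" "adj c3 c4" "adj c4 c5" "adj c5 c1"
    using pent by (auto simp: pentagon_def)
  have "col c1 \<noteq> col c2" "col c2 \<noteq> col c3" "col c3 \<noteq> col c4" "col c4 \<noteq> col c5" "col c5 \<noteq> col c1"
    by (rule proper, rule ac, rule ac, rule cc)+
  then show False by argo
qed

lemma three_colouring:
  assumes "V \<noteq> {}"
  obtains I J where "I \<subseteq> V" "J \<subseteq> V" "I \<inter> J = {}" "indep adj I" "indep adj J" "indep adj (V - I - J)"
  using three_colouring_no_wheel[OF no_wheel assms] .

end

section \<open>Shadows of cancellative 3-graphs\<close>

lemma turan_clique:
  assumes "finite S" "\<And>x y. R x y \<Longrightarrow> R y x" "\<And>x. \<not> R x x"
    and large: "(r - 1) * (card S)^2 < r * card (arcs R S)"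
  obtains W where "W \<subseteq> S" "clique R W" "card W = Suc r"
proof -
  have "\<exists>K. K \<subseteq> S \<and> clique R K \<and> \<not> card K \<le> r"
  proof (rule ccontr)
    assume "\<not> ?thesis"
    then have "r * card (arcs R S) \<le> (r - 1) * (card S)^2"
      by (intro turan_bound[OF assms(1-3)]) simp_all
    then show False using large by simp
  qed
  then obtain K where K: "K \<subseteq> S" "clique R K" "Suc r \<le> card K"
    by (auto simp: not_le Suc_le_eq)
  obtain W where "W \<subseteq> K" "card W = Suc r"
    using obtain_subset_with_card_n[OF K(3)] by metis
  then show thesis
    using that[of W] K(1,2) unfolding clique_def by blast
qed

definition shadow :: "'a set set \<Rightarrow> 'a \<Rightarrow> 'a \<Rightarrow> bool" where
  "shadow E x y \<longleftrightarrow> x \<noteq> y \<and> (\<exists>e\<in>E. x \<in> e \<and> y \<in> e)"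

definition link :: "'a set set \<Rightarrow> 'a \<Rightarrow> ('a \<times> 'a) set" where
  "link E v = {(x, y). {v, x, y} \<in> E}"

lemma shadow_sym: "shadow E x y \<Longrightarrow> shadow E y x"
  by (auto simp: shadow_def)

lemma shadow_irrefl: "\<not> shadow E x x"
  by (simp add: shadow_def)

lemma link_sym: "(x, y) \<in> link E v \<Longrightarrow> (y, x) \<in> link E v"
  by (simp add: link_def insert_commute)

lemma edge_distinct:
  assumes "three_graph V E" "{x, y, z} \<in> E"
  shows "x \<noteq> y" "y \<noteq> z" "x \<noteq> z"
proof -
  have "card {x, y, z} = 3"
    using assms by (simp add: three_graph_def)
  then show "x \<noteq> y" "y \<noteq> z" "x \<noteq> z"
    by (auto simp: card_insert_if split: if_splits)
qed

lemma edge_subset: "three_graph V E \<Longrightarrow> e \<in> E \<Longrightarrow> e \<subseteq> V"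
  by (simp add: three_graph_def)

lemma edge_shadow:
  assumes "three_graph V E" "{x, y, z} \<in> E"
  shows "shadow E x y" "shadow E y z" "shadow E x z"
  using edge_distinct[OF assms] unfolding shadow_def by (auto intro!: bexI[OF _ assms(2)])

lemma edge_complete:
  assumes "three_graph V E" "e \<in> E" "x \<in> e" "y \<in> e" "x \<noteq> y"
  obtains z where "e = {x, y, z}"
proof -
  have "card e = 3"
    using assms by (simp add: three_graph_def)
  then obtain p q r where "e = {p, q, r}"
    by (auto simp: card_3_iff)
  then have "e = {x, y, p} \<or> e = {x, y, q} \<or> e = {x, y, r}"
    using assms(3-5) by auto
  then show thesis
    using that by blast
qed

text \<open>Each edge at \<open>v\<close> gives an ordered pair, selected by \<open>f\<close>, and
  its swap; both lie in the link, and they differ since the two other vertices of the edge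
  do.\<close>

lemma twice_degree_le_card_link:
  assumes "three_graph V E"
  shows "2 * degree E v \<le> card (link E v)"
proof -
  let ?E = "{e \<in> E. v \<in> e}"
  have ex: "\<exists>p. e = {v, fst p, snd p}" if e: "e \<in> ?E" for e
  proof -
    have "card e = 3"
      using e assms by (simp add: three_graph_def)
    then have "\<not> e \<subseteq> {v}"
      using card_mono[of "{v}" e] by auto
    then obtain x where "x \<in> e" "v \<noteq> x" by auto
    then obtain y where "e = {v, x, y}"
      using edge_complete[OF assms, of e v x] e by auto
    then show ?thesis by (intro exI[of _ "(x, y)"]) simp
  qed
  define f where "f e = (SOME p. e = {v, fst p, snd p})" for e
  have f: "e = {v, fst (f e), snd (f e)}" if "e \<in> ?E" for e
    unfolding f_def by (rule someI_ex[OF ex[OF that]])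
  have inj: "inj_on f ?E"
    by (rule inj_onI) (metis f)
  have "link E v \<subseteq> V \<times> V"
    using assms by (auto simp: link_def three_graph_def)
  then have fin: "finite (link E v)"
    using assms by (auto simp: three_graph_def intro: finite_subset)
  have sub: "f ` ?E \<subseteq> link E v"
  proof
    fix p assume "p \<in> f ` ?E"
    then obtain e where "e \<in> ?E" "p = f e" by blast
    then show "p \<in> link E v"
      using f[of e] by (auto simp: link_def case_prod_unfold)
  qed
  have sub': "prod.swap ` f ` ?E \<subseteq> link E v"
    using sub link_sym[of _ _ E v] by (auto simp: prod.swap_def)
  have disj: "f ` ?E \<inter> prod.swap ` f ` ?E = {}"
  proof (rule ccontr)
    assume "\<not> ?thesis"
    then obtain e e' where e: "e \<in> ?E" "e' \<in> ?E" "f e = prod.swap (f e')" by blast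
    then have "e = e'"
      using f[of e] f[of e'] by (metis fst_swap insert_commute snd_swap)
    then have "fst (f e) = snd (f e)"
      using e(3) by (metis fst_swap)
    then show False
      using f[OF e(1)] e(1) edge_distinct(2)[OF assms, of v "fst (f e)" "snd (f e)"] by auto
  qed
  have "2 * degree E v = card (f ` ?E) + card (prod.swap ` f ` ?E)"
    using inj by (simp add: degree_def card_image)
  also have "\<dots> = card (f ` ?E \<union> prod.swap ` f ` ?E)"
    using sub sub' fin disj by (intro card_Un_disjoint[symmetric]) (auto intro: finite_subset)
  also have "\<dots> \<le> card (link E v)"
    using sub sub' fin by (intro card_mono) auto
  finally show ?thesis .
qed

text \<open>An edge \<open>{x, y, c}\<close> would complete the two given edges to
  \<open>K4m\<close> if \<open>c\<close> is \<open>a\<close> or \<open>b\<close>, and to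
  \<open>F5\<close> otherwise. This is cancellativity: no edge contains the symmetric difference of
  two others.\<close>

lemma K4m_F5_free_cancellative:
  assumes H: "three_graph V E" "K4m_F5_free V E"
    and e: "{a, b, x} \<in> E" "{a, b, y} \<in> E" and ne: "x \<noteq> y"
  shows "\<not> shadow E x y"
proof
  assume "shadow E x y"
  then obtain e where "e \<in> E" "x \<in> e" "y \<in> e"
    by (auto simp: shadow_def)
  then obtain c where c: "{x, y, c} \<in> E"
    using edge_complete[OF H(1)] ne by metis
  note d1 = edge_distinct[OF H(1) e(1)] and d2 = edge_distinct[OF H(1) e(2)]
    and d3 = edge_distinct[OF H(1) c]
  have VE: "{a, b, x, y, c} \<subseteq> V"
    using edge_subset[OF H(1)] e c by blast
  have k4: False if "{p, q, x} \<in> E" "{p, q, y} \<in> E" "{p, x, y} \<in> E" for p q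
  proof -
    define f where "f i = (if i = 0 then p else if i = 1 then q else if i = 2 then x else y)" for i :: nat
    have ff: "f 0 = p" "f 1 = q" "f (Suc 0) = q" "f 2 = x" "f 3 = y"
      by (auto simp: f_def)
    have d: "p \<noteq> q" "q \<noteq> x" "p \<noteq> x" "q \<noteq> y" "p \<noteq> y"
      using edge_distinct[OF H(1) that(1)] edge_distinct[OF H(1) that(2)] by auto
    have "subgraph {p, q, x, y} {{p, q, x}, {p, q, y}, {p, x, y}} V E"
      using that H(1) edge_subset[OF H(1)] unfolding subgraph_def three_graph_def by auto
    moreover have "isomorphic K4m_verts K4m_edges {p, q, x, y} {{p, q, x}, {p, q, y}, {p, x, y}}"
      unfolding isomorphic_def K4m_verts_def K4m_edges_def
      using d ne by (intro exI[of _ f]) (auto simp: bij_betw_def inj_on_def ff)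
    ultimately show False
      using H(2) unfolding K4m_F5_free_def contains_copy_def by blast
  qed
  consider "c = a" | "c = b" | "c \<noteq> a" "c \<noteq> b" by blast
  then show False
  proof cases
    case 1
    then show False using k4[of a b] e c by (simp add: insert_commute)
  next
    case 2
    then show False using k4[of b a] e c by (simp add: insert_commute)
  next
    case 3
    define f where "f i = (if i = 0 then a else if i = 1 then b else if i = 2 then x
        else if i = 3 then y else c)" for i :: nat
    have ff: "f 0 = a" "f 1 = b" "f (Suc 0) = b" "f 2 = x" "f 3 = y" "f 4 = c"
      by (auto simp: f_def)
    have "subgraph {a, b, x, y, c} {{a, b, x}, {a, b, y}, {x, y, c}} V E"
      using e c H(1) VE unfolding subgraph_def three_graph_def by auto
    moreover have "isomorphic F5_verts F5_edges {a, b, x, y, c} {{a, b, x}, {a, b, y}, {x, y, c}}"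
      unfolding isomorphic_def F5_verts_def F5_edges_def
      using d1 d2 d3 ne 3 by (intro exI[of _ f]) (auto simp: bij_betw_def inj_on_def ff)
    ultimately show False
      using H(2) unfolding K4m_F5_free_def contains_copy_def by blast
  qed
qed

section \<open>Cliques in the shadow and the transfer to graphs\<close>

locale dense_cancellative =
  fixes V :: "'a set" and E :: "'a set set"
  assumes graph: "three_graph V E" and nonempty: "V \<noteq> {}"
    and cancel: "{a, b, x} \<in> E \<Longrightarrow> {a, b, y} \<in> E \<Longrightarrow> x \<noteq> y \<Longrightarrow> \<not> shadow E x y"
    and large_link: "v \<in> V \<Longrightarrow> 8 / 45 * real (card V)^2 < real (card (link E v))"
begin

definition union_link :: "'a set \<Rightarrow> 'a \<Rightarrow> 'a \<Rightarrow> bool" where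
  "union_link K x y \<longleftrightarrow> (\<exists>a\<in>K. (x, y) \<in> link E a)"

lemma finite_V: "finite V"
  using graph by (simp add: three_graph_def)

lemma link_subset: "link E v \<subseteq> V \<times> V"
  using graph by (auto simp: link_def three_graph_def)

lemma union_link_sym: "union_link K x y \<Longrightarrow> union_link K y x"
  unfolding union_link_def using link_sym by metis

lemma union_link_shadow: "union_link K x y \<Longrightarrow> shadow E x y"
  using edge_shadow(2)[OF graph] by (auto simp: union_link_def link_def)

lemma union_link_irrefl: "\<not> union_link K x x"
  using union_link_shadow shadow_irrefl by metis

lemma link_disjoint:
  assumes "shadow E u v"
  shows "link E u \<inter> link E v = {}"
proof (rule ccontr)
  assume "\<not> ?thesis"
  then obtain x y where "{u, x, y} \<in> E" "{v, x, y} \<in> E"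
    by (auto simp: link_def)
  then have "{x, y, u} \<in> E" "{x, y, v} \<in> E"
    by (simp_all add: insert_commute)
  then show False
    using cancel[of x y u v] assms by (auto simp: shadow_def)
qed

lemma card_union_link:
  assumes "K \<subseteq> V" "clique (shadow E) K" "K \<noteq> {}"
  shows "real (card K) * (8 / 45 * real (card V)^2) < real (card (arcs (union_link K) V))"
proof -
  have fK: "finite K"
    using assms finite_V finite_subset by blast
  have "arcs (union_link K) V = (\<Union>a\<in>K. link E a)"
    using link_subset by (auto simp: arcs_def union_link_def)
  also have "card \<dots> = (\<Sum>a\<in>K. card (link E a))"
  proof (rule card_UN_disjoint[OF fK])
    show "\<forall>a\<in>K. finite (link E a)"
      using finite_subset[OF link_subset] finite_V by blast
    show "\<forall>a\<in>K. \<forall>b\<in>K. a \<noteq> b \<longrightarrow> link E a \<inter> link E b = {}"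
      using assms(2) link_disjoint unfolding clique_def by blast
  qed
  finally have "real (card (arcs (union_link K) V)) = (\<Sum>a\<in>K. real (card (link E a)))"
    by simp
  also have "\<dots> > (\<Sum>a\<in>K. 8 / 45 * real (card V)^2)"
    using assms fK large_link by (intro sum_strict_mono) auto
  finally show ?thesis
    by simp
qed

text \<open>The links over a clique are disjoint, so their union has more than
  \<open>card K * 8/45 * n^2\<close> arcs; the numerical hypothesis says that this reaches the Turan
  bound \<open>(1 - 1/r) * n^2\<close>.\<close>

lemma union_link_clique:
  assumes "K \<subseteq> V" "clique (shadow E) K" "real r * real (card K) * (8 / 45) \<ge> real (r - 1)" "K \<noteq> {}" "r > 0"
  obtains W where "W \<subseteq> V" "clique (union_link K) W" "card W = Suc r"
proof (rule turan_clique[of V "union_link K" r])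
  show "finite V" by (rule finite_V)
  show "union_link K x y \<Longrightarrow> union_link K y x" for x y by (rule union_link_sym)
  show "\<not> union_link K x x" for x by (rule union_link_irrefl)
  have "real (r - 1) * real (card V)^2 \<le> real r * real (card K) * (8 / 45) * real (card V)^2"
    using assms(3) by (rule mult_right_mono) simp
  also have "\<dots> = real r * (real (card K) * (8 / 45 * real (card V)^2))"
    by simp
  also have "\<dots> < real r * real (card (arcs (union_link K) V))"
    using card_union_link[OF assms(1,2,4)] assms(5) by (intro mult_strict_left_mono) auto
  finally have "real ((r - 1) * (card V)^2) < real (r * card (arcs (union_link K) V))"
    by simp
  then show "(r - 1) * (card V)^2 < r * card (arcs (union_link K) V)"
    unfolding of_nat_less_iff .
qed (rule that)

lemma clique_mono: "clique (union_link K) W \<Longrightarrow> clique (shadow E) W"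
  unfolding clique_def using union_link_shadow by blast

text \<open>Six disjoint links would need more than \<open>48/45 * n^2\<close> ordered pairs, but
  there are only \<open>n^2\<close>.\<close>

lemma no_6_clique:
  assumes "K \<subseteq> V" "clique (shadow E) K" "card K = 6"
  shows False
proof -
  have "K \<noteq> {}" using assms by auto
  have "arcs (union_link K) V \<subseteq> V \<times> V" by (auto simp: arcs_def)
  then have "card (arcs (union_link K) V) \<le> card (V \<times> V)"
    using finite_V by (intro card_mono) auto
  then have "real (card (arcs (union_link K) V)) \<le> real (card V)^2"
    by (metis card_cartesian_product of_nat_le_iff of_nat_mult power2_eq_square)
  then show False
    using card_union_link[OF assms(1,2) \<open>K \<noteq> {}\<close>] zero_le_power2[of "real (card V)"]
    unfolding assms(3) of_nat_numeral by linarith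
qed

text \<open>Five links fill more than 8/9 of all ordered pairs, above the Turan threshold 4/5 for a
  clique of size six.\<close>

lemma no_5_clique:
  assumes "K \<subseteq> V" "clique (shadow E) K" "card K = 5"
  shows False
proof -
  have "K \<noteq> {}" using assms by auto
  then obtain W where "W \<subseteq> V" "clique (union_link K) W" "card W = Suc 5"
    using union_link_clique[OF assms(1,2), of 5] assms(3) by auto
  then show False
    using no_6_clique[of W] clique_mono by simp
qed

text \<open>In a clique of four vertices each link is a matching, so six pairs coloured with four links give
  two disjoint pairs in the link of one vertex, which extends the clique.\<close>

lemma no_4_clique:
  assumes K: "K \<subseteq> V" "clique (shadow E) K" "card K = 4"
  shows False
proof -
  have "K \<noteq> {}" "finite K" using K by (auto intro: card_ge_0_finite)
  \<comment> \<open>The guaranteed density \<open>32/45\<close> of four links lies above 2/3 but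
    below 3/4, so Turan's theorem yields only another clique of size four, and its pairs have to be
    examined by the links containing them.\<close>
  then obtain W where W: "W \<subseteq> V" "clique (union_link K) W" "card W = Suc 3"
    using union_link_clique[OF K(1,2), of 3] K(3) by auto
  have fW: "finite W" using W(3) by (auto intro: card_ge_0_finite)
  let ?P = "{s. s \<subseteq> W \<and> card s = 2}"
  have "card ?P = 6"
    using n_subsets[OF fW, of 2] W(3) by (simp add: choose_two)
  have ex: "\<exists>a. a \<in> K \<and> (\<forall>x\<in>s. \<forall>y\<in>s. x \<noteq> y \<longrightarrow> {a, x, y} \<in> E)" if "s \<in> ?P" for s
  proof -
    from that have "card s = 2" by simp
    then obtain x y where s: "s = {x, y}" "x \<noteq> y" by (metis card_2_iff)
    then have "union_link K x y" using W(2) that by (auto simp: clique_def)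
    then obtain a where "a \<in> K" "{a, x, y} \<in> E" by (auto simp: union_link_def link_def)
    then show ?thesis using s by (auto simp: insert_commute)
  qed
  then have "\<exists>f. \<forall>s\<in>?P. f s \<in> K \<and> (\<forall>x\<in>s. \<forall>y\<in>s. x \<noteq> y \<longrightarrow> {f s, x, y} \<in> E)"
    by (intro bchoice ballI)
  then obtain col where c: "\<forall>s\<in>?P. col s \<in> K \<and> (\<forall>x\<in>s. \<forall>y\<in>s. x \<noteq> y \<longrightarrow> {col s, x, y} \<in> E)"
    by (elim exE)
  have col: "col s \<in> K" "x \<in> s \<Longrightarrow> y \<in> s \<Longrightarrow> x \<noteq> y \<Longrightarrow> {col s, x, y} \<in> E" if "s \<in> ?P" for s x y
    using bspec[OF c that] by simp_all
  have "\<not> inj_on col ?P"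
  proof
    assume "inj_on col ?P"
    then have "card ?P \<le> card K"
      using col(1) \<open>finite K\<close> by (intro card_inj_on_le[of col]) auto
    then show False using \<open>card ?P = 6\<close> K(3) by simp
  qed
  then obtain s t where st: "s \<in> ?P" "t \<in> ?P" "s \<noteq> t" "col s = col t"
    by (auto simp: inj_on_def)
  define a where "a = col s"
  have shW: "shadow E x y" if "x \<in> W" "y \<in> W" "x \<noteq> y" for x y
    using clique_mono[OF W(2)] that unfolding clique_def by blast
  have fin: "finite s" "finite t" using st fW by (auto intro: finite_subset)
  show False
  proof (cases "s \<inter> t = {}")
    case True
    then have "card (s \<union> t) = 4" using st fin by (simp add: card_Un_disjoint)
    then have "s \<union> t = W"
      using st W(3) fW by (intro card_subset_eq) auto
    \<comment> \<open>The pairs \<open>s\<close> and \<open>t\<close> cover \<open>W\<close>, so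
      every vertex of \<open>W\<close> shares an edge with \<open>a\<close>.\<close>
    have aW: "shadow E a x" if x: "x \<in> W" for x
    proof -
      obtain r where r: "r \<in> ?P" "col r = a" "x \<in> r"
        using x \<open>s \<union> t = W\<close> st a_def by auto
      then have "card r = 2" by simp
      then obtain y where "y \<in> r" "x \<noteq> y"
        by (metis card_2_iff insertI1 insertI2)
      then have "{a, x, y} \<in> E" using col(2)[OF r(1,3)] r(2) by auto
      then show ?thesis by (rule edge_shadow(1)[OF graph])
    qed
    then have "a \<notin> W" using shadow_irrefl by metis
    have "clique (shadow E) (insert a W)"
      using aW shW shadow_sym unfolding clique_def by (metis insert_iff)
    moreover have "insert a W \<subseteq> V"
      using W(1) K(1) col(1)[OF st(1)] by (auto simp: a_def)
    moreover have "card (insert a W) = 5"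
      using \<open>a \<notin> W\<close> fW W(3) by simp
    ultimately show False using no_5_clique by blast
  next
    case False
    then obtain p where p: "p \<in> s" "p \<in> t" by blast
    have c2: "card s = 2" "card t = 2" using st by auto
    obtain q where q: "s = {p, q}" "p \<noteq> q"
      using p(1) c2(1) by (metis card_2_iff empty_iff insert_commute insert_iff)
    obtain r where r: "t = {p, r}" "p \<noteq> r"
      using p(2) c2(2) by (metis card_2_iff empty_iff insert_commute insert_iff)
    have "q \<noteq> r" using q r st(3) by auto
    have "{a, p, q} \<in> E" "{a, p, r} \<in> E"
      using col(2)[OF st(1), of p q] col(2)[OF st(2), of p r] q r st(4) by (auto simp: a_def)
    then have "\<not> shadow E q r" using cancel \<open>q \<noteq> r\<close> by blast
    moreover have "q \<in> W" "r \<in> W" using q r st by auto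
    ultimately show False using shW \<open>q \<noteq> r\<close> by blast
  qed
qed

sublocale shadow_graph: dense_k4_free V "shadow E"
proof
  show "finite V" by (rule finite_V)
  show "u \<in> V" if "shadow E u v" for u v
    using that edge_subset[OF graph] by (auto simp: shadow_def)
  then have V: "u \<in> V" "v \<in> V" if "shadow E u v" for u v
    using that shadow_sym by metis+
  show "shadow E v u" if "shadow E u v" for u v
    using that by (rule shadow_sym)
  show "\<not> shadow E v v" for v
    by (rule shadow_irrefl)
  show "\<not> shadow E c d" if s: "shadow E a b" "shadow E a c" "shadow E a d" "shadow E b c" "shadow E b d" for a b c d
  proof
    assume cd: "shadow E c d"
    have ne: "a \<noteq> b" "a \<noteq> c" "a \<noteq> d" "b \<noteq> c" "b \<noteq> d" "c \<noteq> d"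
      using s cd by (auto simp: shadow_def)
    have "clique (shadow E) {a, b, c, d}"
      using s cd s[THEN shadow_sym] cd[THEN shadow_sym] by (auto simp: clique_def)
    moreover have "{a, b, c, d} \<subseteq> V"
      using V[OF s(1)] V[OF cd] by simp
    ultimately show False
      using no_4_clique[of "{a, b, c, d}"] ne by simp
  qed
  show "8 / 45 * real (card V)^2 < real (card (arcs (shadow E) {u. shadow E v u}))" if "v \<in> V" for v
  proof -
    have "{u. shadow E v u} \<subseteq> V" using V by blast
    then have "finite {u. shadow E v u}" using finite_V finite_subset by blast
    moreover have "link E v \<subseteq> arcs (shadow E) {u. shadow E v u}"
      using edge_shadow[OF graph] by (auto simp: link_def arcs_def)
    ultimately have "card (link E v) \<le> card (arcs (shadow E) {u. shadow E v u})"
      by (intro card_mono finite_arcs)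
    then show ?thesis using large_link[OF that] by simp
  qed
qed

text \<open>An independent set of the shadow meets an edge at most once, and three vertices in three
  such classes leave exactly one for each.\<close>

lemma three_partite: "three_partite V E"
proof -
  obtain I J where IJ: "I \<subseteq> V" "J \<subseteq> V" "I \<inter> J = {}" "indep (shadow E) I" "indep (shadow E) J"
    "indep (shadow E) (V - I - J)"
    using shadow_graph.three_colouring[OF nonempty] .
  let ?L = "V - I - J"
  have "card (e \<inter> I) = 1 \<and> card (e \<inter> J) = 1 \<and> card (e \<inter> ?L) = 1" if e: "e \<in> E" for e
  proof -
    have eV: "e \<subseteq> V" "card e = 3" "finite e"
      using e graph finite_V by (auto simp: three_graph_def intro: finite_subset)
    have le: "card (e \<inter> S) \<le> 1" if S: "indep (shadow E) S" for S
    proof -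
      have "x = y" if "x \<in> e \<inter> S" "y \<in> e \<inter> S" for x y
        using that S e unfolding indep_def shadow_def by blast
      then show ?thesis
        using eV(3) by (auto simp: card_le_Suc0_iff_eq)
    qed
    have "e = (e \<inter> I) \<union> ((e \<inter> J) \<union> (e \<inter> ?L))" using eV by blast
    then have "3 = card ((e \<inter> I) \<union> ((e \<inter> J) \<union> (e \<inter> ?L)))" using eV by simp
    also have "\<dots> \<le> card (e \<inter> I) + (card (e \<inter> J) + card (e \<inter> ?L))"
      by (meson add_left_mono card_Un_le le_trans)
    finally show ?thesis
      using le[OF IJ(4)] le[OF IJ(5)] le[OF IJ(6)] by simp
  qed
  then show ?thesis
    unfolding three_partite_def using IJ
    by (intro exI[of _ I] exI[of _ J] exI[of _ ?L]) auto
qed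

end

theorem theorem1p2:
  fixes n :: nat and V :: "'a set" and E :: "'a set set"
  assumes "n > 0"
    and "three_graph V E"
    and "card V = n"
    and "K4m_F5_free V E"
    and "real (min_degree V E) > 4 * real n ^ 2 / 45"
  shows "three_partite V E"
proof -
  interpret dense_cancellative V E
  proof
    show "three_graph V E" by fact
    show "V \<noteq> {}" using assms(1,3) by auto
    show "\<not> shadow E x y" if "{a, b, x} \<in> E" "{a, b, y} \<in> E" "x \<noteq> y" for a b x y
      using K4m_F5_free_cancellative[OF assms(2,4) that] .
    show "8 / 45 * real (card V)^2 < real (card (link E v))" if "v \<in> V" for v
    proof -
      have "min_degree V E \<le> degree E v"
        using assms(2) that by (simp add: min_degree_def three_graph_def)
      then have "2 * min_degree V E \<le> card (link E v)"
        using twice_degree_le_card_link[OF assms(2), of v] by linarith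
      then show ?thesis
        using assms(3,5) by simp
    qed
  qed
  show ?thesis by (rule three_partite)
qed

end
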